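(* Assume that $S$ has deficiency indices $\langle 2,2\rangle$ and that its Weyl function, associated with an arbitrary boundary triplet of $S^*$, is not constant (i.e. it is not the case that it is constant on each of the open half-planes $\mathbb{C}_+$ and $\mathbb{C}_-$). Let $\vec{\alpha}\in\mathbb{S}^2$. Then $$\Xi_{\vec{\alpha}}=\bigcup_{\vec{\beta}\in\mathbb{S}^2,\ \vec{\alpha}\cdot\vec{\beta}=0}\Xi_{\vec{\alpha},\vec{\beta}}.$$
   Context: $\mathfrak{H}$ is a complex Hilbert space. A fundamental symmetry is a bounded operator $K$ with $K=K^*$, $K^2=I$; it is non-trivial if $K\neq\pm I$. $J$ and $R$ are fixed non-trivial fundamental symmetries in $\mathfrak{H}$ with $JR=-RJ$. For $\vec{\alpha}=(\alpha_1,\alpha_2,\alpha_3)\in\mathbb{S}^2\subset\mathbb{R}^3$ put $J_{\vec{\alpha}}=\alpha_1J+\alpha_2R+\alpha_3\,iJR$, a non-trivial fundamental symmetry. $S$ is a closed densely defined symmetric operator in $\mathfrak{H}$ such that $SJ=JS$ and $SR=RS$. $\Sigma_{J_{\vec{\alpha}}}=\{A\supset S: J_{\vec{\alpha}}A^*=AJ_{\vec{\alpha}}\}$ is the set of $J_{\vec{\alpha}}$-self-adjoint extensions of $S$, and $\Xi_{\vec{\alpha}}=\{A\in\Sigma_{J_{\vec{\alpha}}}:\rho(A)=\emptyset\}$, where $\rho(A)$ is the resolvent set. For $\vec{\alpha},\vec{\beta}\in\mathbb{S}^2$ with $\vec{\alpha}\cdot\vec{\beta}=0$, the operator $J_{\vec{\gamma}}=iJ_{\vec{\alpha}}J_{\vec{\beta}}$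 is a fundamental symmetry commuting with $S$ (it corresponds to $\vec{\gamma}=\vec{\alpha}\times\vec{\beta}$). The decomposition $\mathfrak{H}=\mathfrak{H}_+^\gamma\oplus\mathfrak{H}_-^\gamma$, $\mathfrak{H}_\pm^\gamma=\frac12(I\pm J_{\vec{\gamma}})\mathfrak{H}$, reduces $S$ to $S=S_{\gamma+}\oplus S_{\gamma-}$. Put $A_\gamma=S_{\gamma+}\oplus S_{\gamma-}^*$, so $A_\gamma^*=S_{\gamma+}^*\oplus S_{\gamma-}$ (adjoints of $S_{\gamma\pm}$ taken in $\mathfrak{H}_\pm^\gamma$), and $\Xi_{\vec{\alpha},\vec{\beta}}=\{A_\gamma,A_\gamma^*\}$. A boundary triplet of $S^*$ is $(\mathcal{H},\Gamma_0,\Gamma_1)$ with $\mathcal{H}$ a Hilbert space and $\Gamma_0,\Gamma_1:\mathcal{D}(S^* )\to\mathcal{H}$ linear, such that $(S^*x,y)-(x,S^*y)=(\Gamma_1x,\Gamma_0y)_{\mathcal{H}}-(\Gamma_0x,\Gamma_1y)_{\mathcal{H}}$ for all $x,y\in\mathcal{D}(S^* )$ and $(\Gamma_0,\Gamma_1):\mathcal{D}(S^* )\to\mathcal{H}\oplus\mathcal{H}$ is surjective. The associated Weyl function $M(\mu)$, $\mu\in\mathbb{C}\setminus\mathbb{R}$, is defined by $M(\mu)\Gamma_0f_\mu=\Gamma_1f_\mu$ for all $f_\mu\in\ker(S^*-\mu I)$. *)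

theory Defs
  imports "HOL-Analysis.Analysis"
begin

text \<open>
  Complex Hilbert spaces as a type class; the inner product is linear in the first argument.
  The axiom \<open>cinner_same\<close> fixes the norm as the one induced by the inner product and
  thereby gives positive definiteness; completeness comes from \<^class>\<open>banach\<close>.
\<close>

class complex_hilbert = banach +
  fixes scaleC :: "complex \<Rightarrow> 'a \<Rightarrow> 'a"  (infixr \<open>*\<^sub>C\<close> 75)
    and cinner :: "'a \<Rightarrow> 'a \<Rightarrow> complex"
  assumes scaleC_add_right: "c *\<^sub>C (x + y) = c *\<^sub>C x + c *\<^sub>C y"
    and scaleC_add_left: "(c + d) *\<^sub>C x = c *\<^sub>C x + d *\<^sub>C x"
    and scaleC_scaleC: "c *\<^sub>C d *\<^sub>C x = (c * d) *\<^sub>C x"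
    and scaleR_scaleC: "r *\<^sub>R x = complex_of_real r *\<^sub>C x"
    and cinner_commute: "cinner x y = cnj (cinner y x)"
    and cinner_add_left: "cinner (x + y) z = cinner x z + cinner y z"
    and cinner_scaleC_left: "cinner (c *\<^sub>C x) y = c * cinner x y"
    and cinner_same: "cinner x x = complex_of_real ((norm x)\<^sup>2)"

instantiation complex :: complex_hilbert
begin
definition scaleC_complex :: "complex \<Rightarrow> complex \<Rightarrow> complex"
  where "scaleC_complex c x = c * x"
definition cinner_complex :: "complex \<Rightarrow> complex \<Rightarrow> complex"
  where "cinner_complex x y = x * cnj y"
instance
  by standard
    (auto simp: scaleC_complex_def cinner_complex_def algebra_simps scaleR_conv_of_real
      complex_norm_square[symmetric] simp flip: of_real_power)
end

interpretation complex_vector: vector_space "scaleC :: complex \<Rightarrow> 'a \<Rightarrow> 'a::complex_hilbert"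
proof
  fix x :: 'a
  show "1 *\<^sub>C x = x"
    using scaleR_scaleC[of 1 x] by simp
qed (simp_all add: scaleC_add_right scaleC_add_left scaleC_scaleC)

definition bounded_clinear :: "('a::complex_hilbert \<Rightarrow> 'a) \<Rightarrow> bool" where
  "bounded_clinear K \<longleftrightarrow> bounded_linear K \<and> (\<forall>c x. K (c *\<^sub>C x) = c *\<^sub>C K x)"

text \<open>
  A possibly unbounded operator is identified with its graph, so that \<open>\<subseteq>\<close> is the
  extension relation and equality of operators includes equality of domains.
\<close>

definition linear_operator :: "('a::complex_hilbert \<times> 'a) set \<Rightarrow> bool" where
  "linear_operator A \<longleftrightarrow> single_valued A \<and> (0, 0) \<in> A \<and>
     (\<forall>x y x' y'. (x, y) \<in> A \<longrightarrow> (x', y') \<in> A \<longrightarrow> (x + x', y + y') \<in> A) \<and>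
     (\<forall>c x y. (x, y) \<in> A \<longrightarrow> (c *\<^sub>C x, c *\<^sub>C y) \<in> A)"

definition gr :: "('a \<Rightarrow> 'a) \<Rightarrow> ('a \<times> 'a) set" where
  "gr K = {(x, K x) | x. True}"

text \<open>The product \<open>A \<odot> B\<close> applies \<open>B\<close> first, on its natural domain.\<close>

definition op_prod :: "('a \<times> 'a) set \<Rightarrow> ('a \<times> 'a) set \<Rightarrow> ('a \<times> 'a) set"  (infixl \<open>\<odot>\<close> 70) where
  "A \<odot> B = B O A"

definition op_sum :: "('a::complex_hilbert \<times> 'a) set \<Rightarrow> ('a \<times> 'a) set \<Rightarrow> ('a \<times> 'a) set" where
  "op_sum A B = {(x + x', y + y') | x y x' y'. (x, y) \<in> A \<and> (x', y') \<in> B}"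

text \<open>
  Adjoint of an operator acting in the closed subspace \<open>H\<close>. It is single-valued if the
  domain of \<open>A\<close> is dense in \<open>H\<close>.
\<close>

definition adjoint_in :: "'a::complex_hilbert set \<Rightarrow> ('a \<times> 'a) set \<Rightarrow> ('a \<times> 'a) set" where
  "adjoint_in H A = {(y, z). y \<in> H \<and> z \<in> H \<and> (\<forall>(x, w) \<in> A. cinner w y = cinner x z)}"

abbreviation op_adjoint :: "('a::complex_hilbert \<times> 'a) set \<Rightarrow> ('a \<times> 'a) set" where
  "op_adjoint A \<equiv> adjoint_in UNIV A"

definition densely_defined :: "('a::complex_hilbert \<times> 'a) set \<Rightarrow> bool" where
  "densely_defined A \<longleftrightarrow> closure (Domain A) = UNIV"

definition symmetric_operator :: "('a::complex_hilbert \<times> 'a) set \<Rightarrow> bool" where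
  "symmetric_operator A \<longleftrightarrow> (\<forall>(x, u) \<in> A. \<forall>(y, v) \<in> A. cinner u y = cinner x v)"

definition resolvent_set :: "('a::complex_hilbert \<times> 'a) set \<Rightarrow> complex set" where
  "resolvent_set A =
     {\<mu>. \<exists>B. bounded_clinear B \<and> {(x, y - \<mu> *\<^sub>C x) | x y. (x, y) \<in> A}\<inverse> = gr B}"

definition eigenspace :: "('a::complex_hilbert \<times> 'a) set \<Rightarrow> complex \<Rightarrow> 'a set" where
  "eigenspace A \<mu> = {f. (f, \<mu> *\<^sub>C f) \<in> A}"

text \<open>
  \<open>dim\<close> is \<open>0\<close> on infinite-dimensional spaces, so this is meaningful for finite positive
  indices only.
\<close>

definition deficiency_indices :: "('a::complex_hilbert \<times> 'a) set \<Rightarrow> nat \<times> nat" where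
  "deficiency_indices S =
     (complex_vector.dim (eigenspace (op_adjoint S) \<i>),
      complex_vector.dim (eigenspace (op_adjoint S) (- \<i>)))"

definition fundamental_symmetry :: "('a::complex_hilbert \<Rightarrow> 'a) \<Rightarrow> bool" where
  "fundamental_symmetry K \<longleftrightarrow>
     bounded_clinear K \<and> op_adjoint (gr K) = gr K \<and> K \<circ> K = id"

definition nontrivial_fundamental_symmetry :: "('a::complex_hilbert \<Rightarrow> 'a) \<Rightarrow> bool" where
  "nontrivial_fundamental_symmetry K \<longleftrightarrow>
     fundamental_symmetry K \<and> K \<noteq> id \<and> K \<noteq> uminus"

definition Jvec :: "('a::complex_hilbert \<Rightarrow> 'a) \<Rightarrow> ('a \<Rightarrow> 'a) \<Rightarrow> real ^ 3 \<Rightarrow> 'a \<Rightarrow> 'a" where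
  "Jvec J R \<alpha> = (\<lambda>x. (\<alpha> $ 1) *\<^sub>R J x + (\<alpha> $ 2) *\<^sub>R R x + (\<alpha> $ 3) *\<^sub>R (\<i> *\<^sub>C J (R x)))"

definition Sigma_ext :: "('a::complex_hilbert \<Rightarrow> 'a) \<Rightarrow> ('a \<times> 'a) set \<Rightarrow> ('a \<times> 'a) set set" where
  "Sigma_ext K S = {A. linear_operator A \<and> S \<subseteq> A \<and> gr K \<odot> op_adjoint A = A \<odot> gr K}"

definition Xi :: "('a::complex_hilbert \<Rightarrow> 'a) \<Rightarrow> ('a \<Rightarrow> 'a) \<Rightarrow> ('a \<times> 'a) set \<Rightarrow> real ^ 3
    \<Rightarrow> ('a \<times> 'a) set set" where
  "Xi J R S \<alpha> = {A \<in> Sigma_ext (Jvec J R \<alpha>) S. resolvent_set A = {}}"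

definition Jgamma :: "('a::complex_hilbert \<Rightarrow> 'a) \<Rightarrow> ('a \<Rightarrow> 'a) \<Rightarrow> real ^ 3 \<Rightarrow> real ^ 3
    \<Rightarrow> 'a \<Rightarrow> 'a" where
  "Jgamma J R \<alpha> \<beta> = (\<lambda>x. \<i> *\<^sub>C Jvec J R \<alpha> (Jvec J R \<beta> x))"

definition Hplus :: "('a::complex_hilbert \<Rightarrow> 'a) \<Rightarrow> 'a set" where
  "Hplus K = range (\<lambda>x. (1 / 2) *\<^sub>R (x + K x))"

definition Hminus :: "('a::complex_hilbert \<Rightarrow> 'a) \<Rightarrow> 'a set" where
  "Hminus K = range (\<lambda>x. (1 / 2) *\<^sub>R (x - K x))"

text \<open>
  \<open>S \<inter> H \<times> H\<close> is the part of \<open>S\<close> in \<open>H\<close>; it is the component of \<open>S\<close> when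
  \<open>H\<close> reduces \<open>S\<close>.
\<close>

definition A_op :: "('a::complex_hilbert \<Rightarrow> 'a) \<Rightarrow> ('a \<times> 'a) set \<Rightarrow> ('a \<times> 'a) set" where
  "A_op K S = op_sum (S \<inter> Hplus K \<times> Hplus K)
                     (adjoint_in (Hminus K) (S \<inter> Hminus K \<times> Hminus K))"

definition Xi2 :: "('a::complex_hilbert \<Rightarrow> 'a) \<Rightarrow> ('a \<Rightarrow> 'a) \<Rightarrow> ('a \<times> 'a) set \<Rightarrow> real ^ 3
    \<Rightarrow> real ^ 3 \<Rightarrow> ('a \<times> 'a) set set" where
  "Xi2 J R S \<alpha> \<beta> = {A_op (Jgamma J R \<alpha> \<beta>) S, op_adjoint (A_op (Jgamma J R \<alpha> \<beta>) S)}"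

text \<open>
  The boundary space is the whole type \<open>'h\<close>; only the values of \<open>\<Gamma>\<^sub>0\<close>, \<open>\<Gamma>\<^sub>1\<close> on the domain
  of the adjoint of \<open>S\<close> are constrained.
\<close>

definition clinear_on :: "'a::complex_hilbert set \<Rightarrow> ('a \<Rightarrow> 'h::complex_hilbert) \<Rightarrow> bool" where
  "clinear_on D f \<longleftrightarrow> (\<forall>x\<in>D. \<forall>y\<in>D. f (x + y) = f x + f y) \<and>
     (\<forall>c. \<forall>x\<in>D. f (c *\<^sub>C x) = c *\<^sub>C f x)"

definition boundary_triplet :: "('a::complex_hilbert \<times> 'a) set \<Rightarrow> ('a \<Rightarrow> 'h::complex_hilbert)
    \<Rightarrow> ('a \<Rightarrow> 'h) \<Rightarrow> bool" where
  "boundary_triplet S \<Gamma>\<^sub>0 \<Gamma>\<^sub>1 \<longleftrightarrow>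
     clinear_on (Domain (op_adjoint S)) \<Gamma>\<^sub>0 \<and> clinear_on (Domain (op_adjoint S)) \<Gamma>\<^sub>1 \<and>
     (\<forall>(x, u) \<in> op_adjoint S. \<forall>(y, v) \<in> op_adjoint S.
        cinner u y - cinner x v = cinner (\<Gamma>\<^sub>1 x) (\<Gamma>\<^sub>0 y) - cinner (\<Gamma>\<^sub>0 x) (\<Gamma>\<^sub>1 y)) \<and>
     (\<lambda>x. (\<Gamma>\<^sub>0 x, \<Gamma>\<^sub>1 x)) ` Domain (op_adjoint S) = UNIV"

text \<open>
  The graph of \<open>M(\<mu>)\<close>. For a boundary triplet and non-real \<open>\<mu>\<close>, \<open>\<Gamma>\<^sub>0\<close> maps the eigenspace
  bijectively onto \<open>'h\<close>, so this is the graph of a function on all of \<open>'h\<close>.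
\<close>

definition weyl_function :: "('a::complex_hilbert \<times> 'a) set \<Rightarrow> ('a \<Rightarrow> 'h::complex_hilbert)
    \<Rightarrow> ('a \<Rightarrow> 'h) \<Rightarrow> complex \<Rightarrow> ('h \<times> 'h) set" where
  "weyl_function S \<Gamma>\<^sub>0 \<Gamma>\<^sub>1 \<mu> = {(\<Gamma>\<^sub>0 f, \<Gamma>\<^sub>1 f) | f. f \<in> eigenspace (op_adjoint S) \<mu>}"

end

theory Submission
  imports Defs
begin

text \<open>
  An operator is a subspace of \<open>H \<times> H\<close>, and taking adjoints is taking annihilators for the
  symplectic form \<open>\<langle>u, y\<rangle> - \<langle>x, v\<rangle>\<close>. The involutions \<open>J\<close>, \<open>R\<close> (in the roles of \<open>J\<^sub>\<alpha>\<close>, \<open>J\<^sub>\<beta>\<close>)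
  split \<open>H\<close> into two copies, exchanged by \<open>R\<close>, of the fixed space of \<open>J\<close>, and \<open>S\<close> acts on each
  copy as one symmetric operator with indices \<open>(1, 1)\<close>, whose defect space at a non-real \<open>\<mu>\<close>
  is a line spanned by some \<open>e\<^sub>\<mu>\<close>.

  Let \<open>A\<close> be \<open>J\<close>-self-adjoint with empty resolvent set. By a dimension count \<open>A\<close> has every
  non-real \<open>\<mu>\<close> as eigenvalue. As \<open>A\<close> is neutral for \<open>symplectic a (lift J b)\<close>, an eigenvector has
  the form \<open>e\<^sub>\<mu> + u R e\<^sub>\<mu>\<close> with \<open>\<bar>u\<bar> = 1\<close>, and neutrality for two points of the same half plane
  forces equal values of \<open>u\<close>. If the Weyl function separates \<open>\<mu>\<close> and \<open>\<nu>\<close>, then \<open>e\<^sub>\<mu>\<close> and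
  \<open>e\<^sub>\<nu>\<close> are independent modulo \<open>S\<close>, so \<open>A\<close> contains \<open>p + u R p\<close> for every \<open>p\<close> in the part of
  \<open>S\<^sup>*\<close> fixed by \<open>J\<close>. This space together with \<open>S\<close> is \<open>A\<^sub>\<gamma>\<close> for the involution \<open>J\<^sub>\<gamma>\<close> that
  is \<open>-1\<close> on all \<open>p + u R p\<close>, and equality holds by maximality.

  Conversely, if a point were in the resolvent set of \<open>A\<^sub>\<gamma>\<close>, then \<open>J\<^sub>\<alpha>\<close>, which exchanges the
  eigenspaces of \<open>J\<^sub>\<gamma>\<close>, would show that \<open>S\<close> is self-adjoint.
\<close>

section \<open>Orthogonal projections\<close>

lemma cinner_add_right: "cinner x (y + z) = cinner x y + cinner x z"
  by (metis cinner_add_left cinner_commute complex_cnj_add)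

lemma cinner_scaleC_right: "cinner x (c *\<^sub>C y) = cnj c * cinner x y"
  by (metis cinner_scaleC_left cinner_commute complex_cnj_mult)

lemma cinner_zero_left [simp]: "cinner 0 y = 0"
  using cinner_add_left[of 0 0 y] by simp

lemma cinner_zero_right [simp]: "cinner x 0 = 0"
  using cinner_add_right[of x 0 0] by simp

lemma cinner_minus_left: "cinner (- x) y = - cinner x y"
  using cinner_add_left[of x "- x" y] by (simp add: eq_neg_iff_add_eq_0 add.commute)

lemma cinner_minus_right: "cinner x (- y) = - cinner x y"
  using cinner_add_right[of x y "- y"] by (simp add: eq_neg_iff_add_eq_0 add.commute)

lemma cinner_diff_left: "cinner (x - y) z = cinner x z - cinner y z"
  using cinner_add_left[of x "- y" z] by (simp add: cinner_minus_left)

lemma cinner_diff_right: "cinner x (y - z) = cinner x y - cinner x z"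
  using cinner_add_right[of x y "- z"] by (simp add: cinner_minus_right)

lemmas cinner_simps = cinner_add_left cinner_add_right cinner_scaleC_left cinner_scaleC_right
  cinner_minus_left cinner_minus_right cinner_diff_left cinner_diff_right

lemma cinner_self_eq_0 [simp]: "cinner x x = 0 \<longleftrightarrow> x = 0"
  by (simp add: cinner_same)

lemma norm_scaleC: "norm (c *\<^sub>C x) = cmod c * norm x"
proof -
  have "complex_of_real ((norm (c *\<^sub>C x))\<^sup>2) = c * cnj c * complex_of_real ((norm x)\<^sup>2)"
    unfolding cinner_same[symmetric] cinner_scaleC_left cinner_scaleC_right by simp
  also have "\<dots> = complex_of_real ((cmod c * norm x)\<^sup>2)"
    by (simp only: complex_norm_square[symmetric] of_real_mult of_real_power power_mult_distrib)
  finally have "(norm (c *\<^sub>C x))\<^sup>2 = (cmod c * norm x)\<^sup>2"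
    by (simp only: of_real_eq_iff)
  then show ?thesis
    by (simp add: power2_eq_iff_nonneg)
qed

lemma norm_diff_scaleC_sq:
  "(norm (w - c *\<^sub>C z))\<^sup>2 = (norm w)\<^sup>2 - 2 * Re (cnj c * cinner w z) + (cmod c * norm z)\<^sup>2"
proof -
  have "complex_of_real ((norm (w - c *\<^sub>C z))\<^sup>2)
      = cinner w w - cnj c * cinner w z - c * cinner z w + c * cnj c * cinner z z"
    by (subst cinner_same[symmetric]) (simp add: cinner_simps algebra_simps)
  also have "c * cinner z w = cnj (cnj c * cinner w z)"
    by (subst cinner_commute) simp
  finally have "Re (complex_of_real ((norm (w - c *\<^sub>C z))\<^sup>2))
      = Re (cinner w w - cnj c * cinner w z - cnj (cnj c * cinner w z) + c * cnj c * cinner z z)"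
    by simp
  then show ?thesis
    by (simp add: cinner_same complex_norm_square[symmetric] power_mult_distrib
        flip: of_real_power of_real_mult)
qed

text \<open>Pythagoras for the part of \<open>w\<close> orthogonal to \<open>z\<close>. It serves
  twice: a nonnegative left side gives Cauchy-Schwarz, and minimality of a distance gives
  orthogonality in \<open>closed_subspace_projection\<close>.\<close>

lemma norm_diff_projection_sq:
  assumes "z \<noteq> 0"
  shows "(norm (w - (cinner w z / (norm z)\<^sup>2) *\<^sub>C z))\<^sup>2 = (norm w)\<^sup>2 - (cmod (cinner w z) / norm z)\<^sup>2"
proof -
  define q where "q = cinner w z"
  have "cnj (q / (norm z)\<^sup>2) * q = complex_of_real ((cmod q)\<^sup>2 / (norm z)\<^sup>2)"
    using complex_norm_square[of q] by (simp add: mult.commute)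
  then have "Re (cnj (q / (norm z)\<^sup>2) * q) = (cmod q)\<^sup>2 / (norm z)\<^sup>2"
    by (simp only: Re_complex_of_real)
  moreover have "cmod (q / (norm z)\<^sup>2) * norm z = cmod q / norm z"
    using assms by (simp add: norm_divide norm_power norm_mult power2_eq_square)
  ultimately show ?thesis
    unfolding norm_diff_scaleC_sq q_def by (simp only: power_divide)
qed

lemma Cauchy_Schwarz_cinner: "cmod (cinner x y) \<le> norm x * norm y"
proof (cases "y = 0")
  case False
  have "0 \<le> (norm x)\<^sup>2 - (cmod (cinner x y) / norm y)\<^sup>2"
    unfolding norm_diff_projection_sq[OF False, symmetric] by simp
  then have "cmod (cinner x y) / norm y \<le> norm x"
    using power2_le_imp_le[of "cmod (cinner x y) / norm y" "norm x"] by simp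
  with False show ?thesis by (simp add: field_simps)
qed simp

lemma parallelogram_law:
  "(norm (x + y))\<^sup>2 + (norm (x - y))\<^sup>2 = 2 * (norm x)\<^sup>2 + 2 * (norm (y::'a::complex_hilbert))\<^sup>2"
  using norm_diff_scaleC_sq[of x 1 y] norm_diff_scaleC_sq[of x "-1" y] by simp

text \<open>A minimising sequence for the distance to \<open>y\<close> is Cauchy by the
  parallelogram law; its limit is the nearest point \<open>m\<close>.\<close>

lemma closed_subspace_projection:
  fixes M :: "'a::complex_hilbert set"
  assumes sub: "complex_vector.subspace M" and "closed M"
  obtains m where "m \<in> M" "\<And>z. z \<in> M \<Longrightarrow> cinner (y - m) z = 0"
proof -
  define d where "d = (INF m\<in>M. norm (y - m))"
  have ne: "M \<noteq> {}" using complex_vector.subspace_0[OF sub] by auto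
  have bdd: "bdd_below ((\<lambda>m. norm (y - m)) ` M)" by (rule bdd_belowI[of _ 0]) auto
  have dle: "d \<le> norm (y - m)" if "m \<in> M" for m
    unfolding d_def using bdd that by (rule cINF_lower)
  have d0: "0 \<le> d" unfolding d_def using ne by (rule cINF_greatest) simp
  have "\<exists>m\<in>M. norm (y - m) < d + 1 / Suc n" for n
    using cINF_less_iff[OF ne bdd, of "d + 1 / Suc n"] by (simp add: d_def)
  then obtain X where X: "\<And>n. X n \<in> M" "\<And>n. norm (y - X n) < d + 1 / Suc n"
    by metis
  \<comment> \<open>The midpoint of \<open>X j\<close> and \<open>X k\<close> lies in
    \<open>M\<close>, hence at distance at least \<open>d\<close> from \<open>y\<close>; the
    parallelogram law leaves little room for the difference.\<close>
  have bound: "(norm (X j - X k))\<^sup>2 \<le> 2 * ((d + 1 / Suc j)\<^sup>2 - d\<^sup>2) + 2 * ((d + 1 / Suc k)\<^sup>2 - d\<^sup>2)"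
    for j k
  proof -
    have "(1/2) *\<^sub>C (X j + X k) \<in> M"
      using X sub by (simp add: complex_vector.subspace_add complex_vector.subspace_scale)
    then have "d \<le> norm (y - (1/2) *\<^sub>C (X j + X k))" by (rule dle)
    moreover have "(y - X j) + (y - X k) = 2 *\<^sub>C (y - (1/2) *\<^sub>C (X j + X k))"
    proof -
      have "2 *\<^sub>C y = y + y" using scaleC_add_left[of 1 1 y] by simp
      then show ?thesis by (simp add: complex_vector.scale_right_diff_distrib)
    qed
    ultimately have "2 * d \<le> norm ((y - X j) + (y - X k))"
      by (simp add: norm_scaleC)
    then have "(2 * d)\<^sup>2 \<le> (norm ((y - X j) + (y - X k)))\<^sup>2"
      using d0 by (intro power_mono) auto
    moreover have "(norm (y - X j))\<^sup>2 \<le> (d + 1 / Suc j)\<^sup>2" "(norm (y - X k))\<^sup>2 \<le> (d + 1 / Suc k)\<^sup>2"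
      using less_imp_le[OF X(2)[of j]] less_imp_le[OF X(2)[of k]] by (auto intro: power_mono)
    moreover have "norm (X j - X k) = norm ((y - X j) - (y - X k))"
      by (simp add: norm_minus_commute)
    ultimately show ?thesis
      using parallelogram_law[of "y - X j" "y - X k"] by (simp add: power_mult_distrib)
  qed
  have lim: "(\<lambda>n. (d + 1 / real (Suc n))\<^sup>2 - d\<^sup>2) \<longlonglongrightarrow> 0"
  proof -
    have "(\<lambda>n. (d + 1 / real (Suc n))\<^sup>2 - d\<^sup>2) \<longlonglongrightarrow> (d + 0)\<^sup>2 - d\<^sup>2"
      using lim_inverse_n'[THEN LIMSEQ_Suc] by (intro tendsto_intros) simp
    then show ?thesis by simp
  qed
  have "Cauchy X"
  proof (rule metric_CauchyI)
    fix e :: real assume "0 < e"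
    then have "0 < e\<^sup>2 / 4" by simp
    from order_tendstoD(2)[OF lim this]
    obtain N where N: "\<And>n. n \<ge> N \<Longrightarrow> (d + 1 / real (Suc n))\<^sup>2 - d\<^sup>2 < e\<^sup>2 / 4"
      by (auto simp: eventually_sequentially)
    have "dist (X j) (X k) < e" if "j \<ge> N" "k \<ge> N" for j k
    proof -
      have "(norm (X j - X k))\<^sup>2 < e\<^sup>2"
        using bound[of j k] N[OF that(1)] N[OF that(2)] by simp
      then show ?thesis
        using \<open>0 < e\<close> by (simp add: dist_norm power_less_imp_less_base)
    qed
    then show "\<exists>N. \<forall>m\<ge>N. \<forall>n\<ge>N. dist (X m) (X n) < e" by blast
  qed
  then obtain m where m: "X \<longlonglongrightarrow> m" using Cauchy_convergent convergent_def by blast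
  have mM: "m \<in> M"
    using \<open>closed M\<close> X(1) m by (rule closed_sequentially)
  have "(\<lambda>n. norm (y - X n)) \<longlonglongrightarrow> norm (y - m)" by (intro tendsto_intros m)
  moreover have "(\<lambda>n. d + 1 / real (Suc n)) \<longlonglongrightarrow> d + 0"
    using lim_inverse_n'[THEN LIMSEQ_Suc] by (intro tendsto_intros) simp
  ultimately have "norm (y - m) \<le> d + 0"
    by (rule LIMSEQ_le) (use X(2) less_imp_le in blast)
  then have nm: "norm (y - m) = d" using dle[OF mM] by simp
  have "cinner (y - m) z = 0" if "z \<in> M" for z
  proof (cases "z = 0")
    case False
    \<comment> \<open>With this coefficient \<open>m + c *\<^sub>C z\<close> would be closer to
      \<open>y\<close> than \<open>m\<close>, unless \<open>y - m\<close> is orthogonal to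
      \<open>z\<close>.\<close>
    define c where "c = cinner (y - m) z / (norm z)\<^sup>2"
    have "m + c *\<^sub>C z \<in> M"
      using mM that sub by (simp add: complex_vector.subspace_add complex_vector.subspace_scale)
    then have "d \<le> norm (y - m - c *\<^sub>C z)" using dle[of "m + c *\<^sub>C z"] by (simp add: diff_diff_eq)
    then have "d\<^sup>2 \<le> (norm (y - m - c *\<^sub>C z))\<^sup>2" using d0 by (intro power_mono)
    also have "\<dots> = d\<^sup>2 - (cmod (cinner (y - m) z) / norm z)\<^sup>2"
      unfolding c_def norm_diff_projection_sq[OF False] nm ..
    finally show ?thesis using False by simp
  qed simp
  then show ?thesis using that mM by blast
qed

section \<open>The symplectic form on pairs\<close>

text \<open>Makes graphs subsets of a complex vector space, so that linearity of an operator becomes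
  \<open>complex_vector.subspace\<close>.\<close>

instantiation prod :: (complex_hilbert, complex_hilbert) complex_hilbert
begin
definition scaleC_prod :: "complex \<Rightarrow> 'a \<times> 'b \<Rightarrow> 'a \<times> 'b"
  where "scaleC_prod c a = (c *\<^sub>C fst a, c *\<^sub>C snd a)"
definition cinner_prod :: "'a \<times> 'b \<Rightarrow> 'a \<times> 'b \<Rightarrow> complex"
  where "cinner_prod a b = cinner (fst a) (fst b) + cinner (snd a) (snd b)"
instance
proof
  fix x y z :: "'a \<times> 'b" and c d :: complex and r :: real
  show "c *\<^sub>C (x + y) = c *\<^sub>C x + c *\<^sub>C y" "(c + d) *\<^sub>C x = c *\<^sub>C x + d *\<^sub>C x"
    "c *\<^sub>C d *\<^sub>C x = (c * d) *\<^sub>C x" "r *\<^sub>R x = complex_of_real r *\<^sub>C x"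
    by (simp_all add: scaleC_prod_def prod_eq_iff scaleC_add_right scaleC_add_left scaleC_scaleC
        scaleR_scaleC)
  show "cinner x y = cnj (cinner y x)"
    unfolding cinner_prod_def using cinner_commute[of "fst x"] cinner_commute[of "snd x"]
    by (metis complex_cnj_add)
  show "cinner (x + y) z = cinner x z + cinner y z" "cinner (c *\<^sub>C x) y = c * cinner x y"
    by (simp_all add: cinner_prod_def scaleC_prod_def cinner_simps algebra_simps)
  show "cinner x x = complex_of_real ((norm x)\<^sup>2)"
    by (simp add: cinner_prod_def cinner_same norm_prod_def flip: of_real_power of_real_add)
qed
end

lemma fst_scaleC [simp]: "fst (c *\<^sub>C a) = c *\<^sub>C fst a"
  and snd_scaleC [simp]: "snd (c *\<^sub>C a) = c *\<^sub>C snd a"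
  by (simp_all add: scaleC_prod_def)

text \<open>On \<open>op_adjoint S\<close> this is the left side of Green's identity for boundary
  triplets.\<close>

definition symplectic :: "'a::complex_hilbert \<times> 'a \<Rightarrow> 'a \<times> 'a \<Rightarrow> complex"
  where "symplectic a b = cinner (snd a) (fst b) - cinner (fst a) (snd b)"

lemma symplectic_simps:
  "symplectic (a + b) c = symplectic a c + symplectic b c"
  "symplectic a (b + c) = symplectic a b + symplectic a c"
  "symplectic (a - b) c = symplectic a c - symplectic b c"
  "symplectic a (b - c) = symplectic a b - symplectic a c"
  "symplectic (k *\<^sub>C a) b = k * symplectic a b"
  "symplectic a (k *\<^sub>C b) = cnj k * symplectic a b"
  "symplectic (- a) b = - symplectic a b"
  "symplectic a (- b) = - symplectic a b"
  "symplectic 0 b = 0"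
  "symplectic a 0 = 0"
  by (simp_all add: symplectic_def cinner_simps algebra_simps)

lemma symplectic_commute: "symplectic b a = - cnj (symplectic a b)"
  unfolding symplectic_def
  using cinner_commute[of "snd b" "fst a"] cinner_commute[of "fst b" "snd a"] by simp

lemma op_adjoint_eq: "op_adjoint A = {b. \<forall>a\<in>A. symplectic a b = 0}"
  by (auto simp: adjoint_in_def symplectic_def)

lemma mem_op_adjoint: "b \<in> op_adjoint A \<longleftrightarrow> (\<forall>a\<in>A. symplectic a b = 0)"
  by (simp add: op_adjoint_eq)

lemma subspace_op_adjoint: "complex_vector.subspace (op_adjoint A)"
  by (rule complex_vector.subspaceI) (auto simp: mem_op_adjoint symplectic_simps)

lemma linear_operator_iff_subspace:
  "linear_operator A \<longleftrightarrow> single_valued A \<and> complex_vector.subspace A"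
  unfolding linear_operator_def complex_vector.subspace_def
  by (simp add: scaleC_prod_def zero_prod_def Ball_def)

text \<open>Eigenvectors are kept as points of a graph, where they combine linearly with elements of
  \<open>S\<close>.\<close>

definition eigenpair :: "complex \<Rightarrow> 'a::complex_hilbert \<Rightarrow> 'a \<times> 'a"
  where "eigenpair \<mu> x = (x, \<mu> *\<^sub>C x)"

lemma eigenspace_iff: "x \<in> eigenspace A \<mu> \<longleftrightarrow> eigenpair \<mu> x \<in> A"
  by (simp add: eigenspace_def eigenpair_def)

lemma eigenpair_simps:
  "eigenpair \<mu> (x + y) = eigenpair \<mu> x + eigenpair \<mu> y"
  "eigenpair \<mu> (x - y) = eigenpair \<mu> x - eigenpair \<mu> y"
  "eigenpair \<mu> (c *\<^sub>C x) = c *\<^sub>C eigenpair \<mu> x"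
  "eigenpair \<mu> 0 = 0"
  "fst (eigenpair \<mu> x) = x"
  "snd (eigenpair \<mu> x) = \<mu> *\<^sub>C x"
  by (simp_all add: eigenpair_def prod_eq_iff scaleC_add_right scaleC_scaleC mult.commute
      complex_vector.scale_right_diff_distrib)

lemma symplectic_eigenpair:
  "symplectic (eigenpair \<mu> x) (eigenpair \<nu> y) = (\<mu> - cnj \<nu>) * cinner x y"
  by (simp add: symplectic_def eigenpair_def cinner_simps algebra_simps)

text \<open>Up to the factor \<open>2 * \<i>\<close> the form is definite on eigenpairs at a
  non-real point, with the sign of the half plane. All sign arguments rest on this.\<close>

lemma symplectic_eigenpair_self:
  "symplectic (eigenpair \<mu> x) (eigenpair \<mu> x) = 2 * \<i> * complex_of_real (Im \<mu> * (norm x)\<^sup>2)"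
  by (simp add: symplectic_eigenpair cinner_same complex_eq_iff)

text \<open>The operator \<open>A - \<mu>\<close>, read on the graph of \<open>A\<close>.\<close>

definition shift :: "complex \<Rightarrow> 'a::complex_hilbert \<times> 'a \<Rightarrow> 'a"
  where "shift \<mu> a = snd a - \<mu> *\<^sub>C fst a"

lemma shift_simps:
  "shift \<mu> (a + b) = shift \<mu> a + shift \<mu> b"
  "shift \<mu> (a - b) = shift \<mu> a - shift \<mu> b"
  "shift \<mu> (c *\<^sub>C a) = c *\<^sub>C shift \<mu> a"
  "shift \<mu> 0 = 0"
  "shift \<mu> (eigenpair \<nu> x) = (\<nu> - \<mu>) *\<^sub>C x"
  by (simp_all add: shift_def eigenpair_def scaleC_add_right scaleC_scaleC mult.commute
      complex_vector.scale_right_diff_distrib complex_vector.scale_left_diff_distrib)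

lemma shift_eq_0_iff: "shift \<mu> a = 0 \<longleftrightarrow> a = eigenpair \<mu> (fst a)"
  by (auto simp: shift_def eigenpair_def prod_eq_iff)

section \<open>Closed symmetric operators\<close>

locale closed_symmetric =
  fixes S :: "('a::complex_hilbert \<times> 'a) set"
  assumes linear_S: "linear_operator S"
    and closed_S: "closed S"
    and dense_S: "densely_defined S"
    and symmetric_S: "symmetric_operator S"
begin

abbreviation T where "T \<equiv> op_adjoint S"

lemma subspace_S: "complex_vector.subspace S"
  using linear_S by (simp add: linear_operator_iff_subspace)

lemma subspace_T: "complex_vector.subspace T"
  by (rule subspace_op_adjoint)

lemmas S_closed = complex_vector.subspace_add[OF subspace_S] complex_vector.subspace_diff[OF subspace_S]
  complex_vector.subspace_scale[OF subspace_S] complex_vector.subspace_0[OF subspace_S]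

lemmas T_closed = complex_vector.subspace_add[OF subspace_T] complex_vector.subspace_diff[OF subspace_T]
  complex_vector.subspace_scale[OF subspace_T] complex_vector.subspace_0[OF subspace_T]

lemma symplectic_S_T: "a \<in> S \<Longrightarrow> b \<in> T \<Longrightarrow> symplectic a b = 0"
  by (simp add: mem_op_adjoint)

lemma symplectic_T_S: "a \<in> T \<Longrightarrow> b \<in> S \<Longrightarrow> symplectic a b = 0"
  by (subst symplectic_commute) (simp add: symplectic_S_T)

lemma S_subset_T: "S \<subseteq> T"
  using symmetric_S by (fastforce simp: symmetric_operator_def mem_op_adjoint symplectic_def)

text \<open>The difference of two values is orthogonal to the dense domain of
  \<open>S\<close>.\<close>

lemma single_valued_T: "single_valued T"
proof (rule single_valuedI)
  fix x y z assume "(x, y) \<in> T" "(x, z) \<in> T"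
  from complex_vector.subspace_diff[OF subspace_T this]
  have "(0, y - z) \<in> T" by simp
  then have orth: "cinner w (y - z) = 0" if "w \<in> Domain S" for w
    using that by (force simp: mem_op_adjoint symplectic_def)
  have "y - z \<in> closure (Domain S)"
    using dense_S by (simp add: densely_defined_def)
  then obtain W where W: "\<And>n. W n \<in> Domain S" "W \<longlonglongrightarrow> y - z"
    by (auto simp: closure_sequential)
  have "(norm (y - z))\<^sup>2 \<le> norm (y - z - W n) * norm (y - z)" for n
  proof -
    have "complex_of_real ((norm (y - z))\<^sup>2) = cinner (y - z - W n) (y - z)"
      using orth[OF W(1)[of n]] cinner_diff_left[of "y - z" "W n" "y - z"] by (simp add: cinner_same)
    then have "(norm (y - z))\<^sup>2 = cmod (cinner (y - z - W n) (y - z))"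
      by (metis norm_of_real abs_of_nonneg zero_le_power2)
    then show ?thesis using Cauchy_Schwarz_cinner by metis
  qed
  moreover have "(\<lambda>n. norm (y - z - W n) * norm (y - z)) \<longlonglongrightarrow> norm (y - z - (y - z)) * norm (y - z)"
    by (intro tendsto_intros W)
  ultimately have "(norm (y - z))\<^sup>2 \<le> norm (y - z - (y - z)) * norm (y - z)"
    by (intro LIMSEQ_le_const) auto
  then show "y = z" by simp
qed

text \<open>By symmetry \<open>cinner (snd a) (fst a)\<close> is real, so the imaginary part of
  \<open>cinner (shift \<mu> a) (fst a)\<close> comes from \<mu> alone; Cauchy-Schwarz
  finishes.\<close>

lemma norm_shift_ge:
  assumes "a \<in> S"
  shows "\<bar>Im \<mu>\<bar> * norm (fst a) \<le> norm (shift \<mu> a)"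
proof -
  have "symplectic a a = 0" using assms S_subset_T symplectic_S_T by blast
  then have "cinner (snd a) (fst a) = cinner (fst a) (snd a)"
    by (simp add: symplectic_def)
  then have real: "Im (cinner (snd a) (fst a)) = 0"
    using cinner_commute[of "snd a" "fst a"] by (simp add: complex_eq_iff)
  have "Im (cinner (shift \<mu> a) (fst a)) = - (Im \<mu> * (norm (fst a))\<^sup>2)"
    by (simp add: shift_def cinner_simps cinner_same real)
  then have "\<bar>Im \<mu>\<bar> * (norm (fst a))\<^sup>2 \<le> cmod (cinner (shift \<mu> a) (fst a))"
    by (metis abs_Im_le_cmod abs_minus_cancel abs_mult abs_of_nonneg zero_le_power2)
  also have "\<dots> \<le> norm (shift \<mu> a) * norm (fst a)" by (rule Cauchy_Schwarz_cinner)
  finally show ?thesis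
    by (cases "fst a = 0") (auto simp: power2_eq_square)
qed

lemma subspace_range_shift: "complex_vector.subspace (shift \<mu> ` S)"
proof (rule complex_vector.subspaceI)
  show "0 \<in> shift \<mu> ` S" using S_closed(4) by (force simp: shift_simps)
next
  fix x y assume "x \<in> shift \<mu> ` S" "y \<in> shift \<mu> ` S"
  then show "x + y \<in> shift \<mu> ` S"
    using S_closed(1) by (auto simp flip: shift_simps)
next
  fix c x assume "x \<in> shift \<mu> ` S"
  then show "c *\<^sub>C x \<in> shift \<mu> ` S"
    using S_closed(3) by (auto simp flip: shift_simps)
qed

text \<open>By \<open>norm_shift_ge\<close>, convergence of the images makes the first entries
  Cauchy; closedness of \<open>S\<close> catches the limit.\<close>

lemma closed_range_shift:
  assumes "Im \<mu> \<noteq> 0"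
  shows "closed (shift \<mu> ` S)"
  unfolding closed_sequential_limits
proof (intro allI impI)
  fix Y l assume "(\<forall>n. Y n \<in> shift \<mu> ` S) \<and> Y \<longlonglongrightarrow> l"
  then have Y: "\<And>n. Y n \<in> shift \<mu> ` S" "Y \<longlonglongrightarrow> l" by auto
  then have "\<exists>a. a \<in> S \<and> Y n = shift \<mu> a" for n by blast
  then obtain X where X: "\<And>n. X n \<in> S" "\<And>n. Y n = shift \<mu> (X n)" by metis
  have "Cauchy (\<lambda>n. fst (X n))"
  proof (rule metric_CauchyI)
    fix e :: real assume "0 < e"
    then have "0 < \<bar>Im \<mu>\<bar> * e" using assms by simp
    from metric_CauchyD[OF LIMSEQ_imp_Cauchy[OF Y(2)] this]
    obtain N where N: "\<And>m n. m \<ge> N \<Longrightarrow> n \<ge> N \<Longrightarrow> dist (Y m) (Y n) < \<bar>Im \<mu>\<bar> * e" by blast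
    have "dist (fst (X m)) (fst (X n)) < e" if "m \<ge> N" "n \<ge> N" for m n
    proof -
      have "\<bar>Im \<mu>\<bar> * norm (fst (X m) - fst (X n)) \<le> dist (Y m) (Y n)"
        using norm_shift_ge[OF S_closed(2)[OF X(1) X(1)], of \<mu> m n]
        by (simp add: X(2) dist_norm shift_simps)
      also have "\<dots> < \<bar>Im \<mu>\<bar> * e" by (rule N[OF that])
      finally show ?thesis using assms by (simp add: dist_norm)
    qed
    then show "\<exists>N. \<forall>m\<ge>N. \<forall>n\<ge>N. dist (fst (X m)) (fst (X n)) < e" by blast
  qed
  then obtain x where x: "(\<lambda>n. fst (X n)) \<longlonglongrightarrow> x" using Cauchy_convergent convergent_def by blast
  have "(\<lambda>n. \<mu> *\<^sub>C fst (X n)) \<longlonglongrightarrow> \<mu> *\<^sub>C x"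
  proof (rule LIM_zero_cancel, rule tendsto_norm_zero_cancel)
    have "(\<lambda>n. cmod \<mu> * norm (fst (X n) - x)) \<longlonglongrightarrow> cmod \<mu> * norm (x - x)"
      by (intro tendsto_intros x)
    then show "(\<lambda>n. norm (\<mu> *\<^sub>C fst (X n) - \<mu> *\<^sub>C x)) \<longlonglongrightarrow> 0"
      by (simp add: norm_scaleC flip: complex_vector.scale_right_diff_distrib)
  qed
  then have "(\<lambda>n. (fst (X n), Y n + \<mu> *\<^sub>C fst (X n))) \<longlonglongrightarrow> (x, l + \<mu> *\<^sub>C x)"
    by (intro tendsto_intros x Y)
  moreover have "(fst (X n), Y n + \<mu> *\<^sub>C fst (X n)) = X n" for n
    by (simp add: X(2) shift_def)
  ultimately have "(x, l + \<mu> *\<^sub>C x) \<in> S"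
    using closed_sequentially[OF closed_S, of X] X(1) by simp
  then show "l \<in> shift \<mu> ` S" by (force simp: shift_def)
qed

text \<open>The orthogonal complement of the closed range is the defect space at
  \<open>cnj \<mu>\<close>. Orthogonality of the parts is recorded for the later resolvent
  estimate.\<close>

lemma range_shift_decomposition:
  assumes "Im \<mu> \<noteq> 0"
  obtains s w where "s \<in> S" "w \<in> eigenspace T (cnj \<mu>)" "y = shift \<mu> s + w" 
    "cinner w (shift \<mu> s) = 0"
proof -
  obtain m where m: "m \<in> shift \<mu> ` S" "\<And>z. z \<in> shift \<mu> ` S \<Longrightarrow> cinner (y - m) z = 0"
    using closed_subspace_projection[OF subspace_range_shift closed_range_shift[OF assms]] by metis
  from m(1) obtain s where s: "s \<in> S" "m = shift \<mu> s" by blast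
  have "eigenpair (cnj \<mu>) (y - m) \<in> T"
    unfolding mem_op_adjoint
  proof
    fix a assume "a \<in> S"
    then have "cinner (y - m) (shift \<mu> a) = 0" using m(2) by blast
    then have "cinner (shift \<mu> a) (y - m) = 0" using cinner_commute[of "shift \<mu> a"] by simp
    then show "symplectic a (eigenpair (cnj \<mu>) (y - m)) = 0"
      unfolding symplectic_def eigenpair_def shift_def cinner_diff_left cinner_scaleC_left fst_conv
        snd_conv cinner_scaleC_right by simp
  qed
  then show ?thesis
    using that[of s "y - m"] s m by (simp add: eigenspace_iff)
qed

lemma von_Neumann:
  assumes "a \<in> T" and im: "Im \<mu> \<noteq> 0"
  obtains s n m where "s \<in> S" "n \<in> eigenspace T \<mu>" "m \<in> eigenspace T (cnj \<mu>)"
    "a = s + eigenpair \<mu> n + eigenpair (cnj \<mu>) m"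
proof -
  obtain s w where s: "s \<in> S" "w \<in> eigenspace T (cnj \<mu>)" "shift \<mu> a = shift \<mu> s + w"
    using range_shift_decomposition[OF im] by metis
  have ne: "cnj \<mu> - \<mu> \<noteq> 0" using im by (auto simp: complex_eq_iff)
  \<comment> \<open>\<open>shift \<mu>\<close> sends \<open>eigenpair (cnj \<mu>) m\<close> to
    \<open>(cnj \<mu> - \<mu>) *\<^sub>C m\<close>, which is \<open>w\<close> for this
    \<open>m\<close>. The remainder \<open>b\<close> is then annihilated, so it is an eigenpair at
    \<mu>.\<close>
  define m where "m = (1 / (cnj \<mu> - \<mu>)) *\<^sub>C w"
  have m: "eigenpair (cnj \<mu>) m \<in> T"
    using s(2) T_closed(3) by (simp add: m_def eigenspace_iff eigenpair_simps)
  define b where "b = a - s - eigenpair (cnj \<mu>) m"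
  have "shift \<mu> b = 0"
    using ne by (simp add: b_def shift_simps s(3) m_def)
  then have b: "b = eigenpair \<mu> (fst b)" by (simp add: shift_eq_0_iff)
  have "b \<in> T" using m s(1) assms(1) S_subset_T by (auto simp: b_def intro!: T_closed)
  show ?thesis
  proof (rule that[OF s(1), of "fst b" m])
    show "fst b \<in> eigenspace T \<mu>" "m \<in> eigenspace T (cnj \<mu>)"
      using \<open>b \<in> T\<close> b m by (simp_all add: eigenspace_iff)
    show "a = s + eigenpair \<mu> (fst b) + eigenpair (cnj \<mu>) m"
      unfolding b[symmetric] by (simp add: b_def)
  qed
qed

text \<open>The form is definite on each defect space at \<open>\<i>\<close> and
  \<open>- \<i>\<close> and vanishes between them, so testing \<open>a\<close> against its own
  defect components kills both.\<close>

lemma S_double_adjoint: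
  assumes "a \<in> T" and orth: "\<And>b. b \<in> T \<Longrightarrow> symplectic a b = 0"
  shows "a \<in> S"
proof -
  obtain s n m where *: "s \<in> S" "n \<in> eigenspace T \<i>" "m \<in> eigenspace T (cnj \<i>)"
    "a = s + eigenpair \<i> n + eigenpair (cnj \<i>) m"
    using von_Neumann[OF assms(1), of \<i>] by (metis imaginary_unit.sel(2) zero_neq_one)
  have "symplectic a (eigenpair \<i> n) = 0" "symplectic a (eigenpair (cnj \<i>) m) = 0"
    using *(2,3) by (auto simp: eigenspace_iff intro!: orth)
  then have "n = 0" "m = 0"
    using * by (simp_all add: symplectic_simps symplectic_S_T symplectic_eigenpair eigenspace_iff)
  with * show ?thesis by (simp add: eigenpair_simps)
qed

text \<open>Modulo \<open>S\<close>, eigenvectors from opposite half planes span definite subspaces of opposite sign.\<close>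

lemma opposite_half_planes:
  assumes "n \<in> eigenspace T \<mu>" "m \<in> eigenspace T \<nu>" "Im \<mu> * Im \<nu> < 0"
    and "eigenpair \<mu> n - eigenpair \<nu> m \<in> S"
  shows "n = 0"
proof -
  let ?a = "eigenpair \<mu> n" and ?b = "eigenpair \<nu> m"
  have T: "?a \<in> T" "?b \<in> T" using assms by (simp_all add: eigenspace_iff)
  \<comment> \<open>Both self-pairings equal the mixed value \<open>symplectic ?b ?a\<close>,
    although their signs are opposite.\<close>
  have "symplectic (?a - ?b) ?a = 0" "symplectic ?b (?a - ?b) = 0"
    using T assms(4) symplectic_S_T symplectic_T_S by blast+
  then have "symplectic ?a ?a = symplectic ?b ?b" by (simp add: symplectic_simps)
  then have eq: "Im \<mu> * (norm n)\<^sup>2 = Im \<nu> * (norm m)\<^sup>2"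
    unfolding symplectic_eigenpair_self by (simp flip: of_real_mult of_real_power)
  have "(Im \<mu> * Im \<mu>) * (norm n)\<^sup>2 = (Im \<mu> * Im \<nu>) * (norm m)\<^sup>2"
    using eq by (simp add: mult.assoc)
  also have "\<dots> \<le> 0" using assms(3) by (simp add: mult_nonpos_nonneg)
  finally have "(Im \<mu> * Im \<mu>) * (norm n)\<^sup>2 \<le> 0" .
  moreover have "0 < Im \<mu> * Im \<mu>" using assms(3) by (cases "Im \<mu> = 0") (auto simp: mult_eq_0_iff simp flip: power2_eq_square)
  ultimately have "(norm n)\<^sup>2 \<le> 0" by (metis mult_le_0_iff not_le)
  then show ?thesis by simp
qed

end

section \<open>Reducing involutions and the operators \<open>A\<^sub>\<gamma>\<close>\<close>

definition lift :: "('a \<Rightarrow> 'a) \<Rightarrow> 'a \<times> 'a \<Rightarrow> 'a \<times> 'a"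
  where "lift K a = (K (fst a), K (snd a))"

lemma half_sum_diff:
  fixes a b :: "'a::complex_hilbert"
  shows "(1/2) *\<^sub>C (a + b) + (1/2) *\<^sub>C (a - b) = a"
proof -
  have "(1/2) *\<^sub>C a + (1/2) *\<^sub>C a = a"
    using scaleC_add_left[of "1/2" "1/2" a] by simp
  then show ?thesis
    by (simp add: scaleC_add_right complex_vector.scale_right_diff_distrib)
qed

lemma half_add_self [simp]: "(1/2) *\<^sub>C (a + a) = (a::'a::complex_hilbert)"
  using half_sum_diff[of a a] by simp

lemma resolvent_graph:
  "{(x, y - \<mu> *\<^sub>C x) | x y. (x, y) \<in> A} = (\<lambda>a. (fst a, shift \<mu> a)) ` A"
  unfolding shift_def image_def Bex_def split_paired_Ex by auto

locale symmetric_involution =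
  fixes K :: "'a::complex_hilbert \<Rightarrow> 'a"
  assumes add: "K (x + y) = K x + K y"
    and scaleC: "K (c *\<^sub>C x) = c *\<^sub>C K x"
    and involutive [simp]: "K (K x) = x"
    and symmetric: "cinner (K x) y = cinner x (K y)"
begin

lemma zero [simp]: "K 0 = 0"
  using add[of 0 0] by simp

lemma minus: "K (- x) = - K x"
  using add[of x "- x"] by (simp add: eq_neg_iff_add_eq_0 add.commute)

lemma diff: "K (x - y) = K x - K y"
  using add[of x "- y"] by (simp add: minus)

lemmas simps = add scaleC minus diff

lemma lift_simps:
  "lift K (a + b) = lift K a + lift K b"
  "lift K (a - b) = lift K a - lift K b"
  "lift K (- a) = - lift K a"
  "lift K (c *\<^sub>C a) = c *\<^sub>C lift K a"
  "lift K 0 = 0"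
  "lift K (lift K a) = a"
  "lift K (eigenpair \<mu> x) = eigenpair \<mu> (K x)"
  by (simp_all add: lift_def prod_eq_iff simps eigenpair_def)

lemma symplectic_lift: "symplectic (lift K a) b = symplectic a (lift K b)"
  by (simp add: symplectic_def lift_def symmetric)

lemma symplectic_lift_lift: "symplectic (lift K a) (lift K b) = symplectic a b"
  by (simp add: symplectic_lift lift_simps)

lemma Hplus_eq: "Hplus K = {x. K x = x}"
proof
  show "Hplus K \<subseteq> {x. K x = x}"
    by (auto simp: Hplus_def simps scaleR_scaleC add.commute)
  show "{x. K x = x} \<subseteq> Hplus K"
  proof
    fix x assume "x \<in> {x. K x = x}"
    then show "x \<in> Hplus K" unfolding Hplus_def by (intro image_eqI[of _ _ x]) (auto simp: scaleR_scaleC)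
  qed
qed

lemma Hminus_eq: "Hminus K = {x. K x = - x}"
proof
  show "Hminus K \<subseteq> {x. K x = - x}"
    by (auto simp: Hminus_def simps scaleR_scaleC simp flip: complex_vector.scale_minus_right)
  show "{x. K x = - x} \<subseteq> Hminus K"
  proof
    fix x assume "x \<in> {x. K x = - x}"
    then show "x \<in> Hminus K" unfolding Hminus_def by (intro image_eqI[of _ _ x]) (auto simp: scaleR_scaleC)
  qed
qed

lemma uminus: "symmetric_involution (\<lambda>x. - K x)"
  by unfold_locales (simp_all add: simps cinner_simps symmetric)

end

lemma fundamental_symmetry_imp_symmetric_involution:
  assumes "fundamental_symmetry K"
  shows "symmetric_involution K"
proof
  have *: "bounded_clinear K" "op_adjoint (gr K) = gr K" "K \<circ> K = id"
    using assms by (simp_all add: fundamental_symmetry_def)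
  show "K (x + y) = K x + K y" "K (c *\<^sub>C x) = c *\<^sub>C K x" for x y c
    using *(1) by (simp_all add: bounded_clinear_def linear_add bounded_linear.linear)
  show "K (K x) = x" for x using *(3) by (metis comp_apply id_apply)
  show "cinner (K x) y = cinner x (K y)" for x y
  proof -
    have "(y, K y) \<in> op_adjoint (gr K)" using *(2) by (simp add: gr_def)
    then show ?thesis by (force simp: adjoint_in_def gr_def)
  qed
qed

text \<open>Turns operator identities into membership of points. It serves both commutation with
  \<open>S\<close> (where \<open>B = A\<close>) and \<open>J\<close>-self-adjointness (where
  \<open>B\<close> is the adjoint).\<close>

lemma op_prod_gr_eq_iff:
  assumes "\<And>x. K (K x) = x"
  shows "gr K \<odot> B = A \<odot> gr K \<longleftrightarrow> (\<forall>a. a \<in> B \<longleftrightarrow> lift K a \<in> A)"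
proof -
  have "(\<exists>y. (x, y) \<in> B \<and> z = K y) \<longleftrightarrow> (x, K z) \<in> B" for x z
    by (metis assms)
  then have "gr K \<odot> B = {(x, z). (x, K z) \<in> B}"
    by (simp add: op_prod_def gr_def relcomp_unfold)
  moreover have "A \<odot> gr K = {(x, z). (K x, z) \<in> A}"
    by (simp add: op_prod_def gr_def relcomp_unfold)
  ultimately have "gr K \<odot> B = A \<odot> gr K \<longleftrightarrow> (\<forall>x z. (x, K z) \<in> B \<longleftrightarrow> (K x, z) \<in> A)"
    by (auto simp: set_eq_iff)
  also have "\<dots> \<longleftrightarrow> (\<forall>x z. (x, z) \<in> B \<longleftrightarrow> (K x, K z) \<in> A)"
    using assms by metis
  finally show ?thesis by (simp add: lift_def)
qed

lemma op_sum_eq: "op_sum A B = {a + b | a b. a \<in> A \<and> b \<in> B}"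
  unfolding op_sum_def split_paired_Ex by simp

text \<open>The assumption expresses commutation of \<open>K\<close> with \<open>S\<close>; as
  \<open>K\<close> is involutive, invariance of the graph under \<open>lift K\<close> is an
  equivalence (\<open>lift_S_iff\<close>).\<close>

locale reducing_involution = closed_symmetric S + symmetric_involution K
  for S :: "('a::complex_hilbert \<times> 'a) set" and K +
  assumes lift_S: "a \<in> S \<Longrightarrow> lift K a \<in> S"
begin

lemma lift_T: "a \<in> T \<Longrightarrow> lift K a \<in> T"
  by (auto simp: mem_op_adjoint symplectic_lift[symmetric] intro: lift_S)

lemma lift_S_iff: "lift K a \<in> S \<longleftrightarrow> a \<in> S"
  using lift_S lift_simps(6) by metis

lemma uminus: "reducing_involution S (\<lambda>x. - K x)"
proof -
  interpret symmetric_involution "\<lambda>x. - K x" by (rule uminus)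
  show ?thesis
  proof
    fix a assume "a \<in> S"
    then have "(- 1) *\<^sub>C lift K a \<in> S" by (intro S_closed lift_S)
    then show "lift (\<lambda>x. - K x) a \<in> S" by (simp add: lift_def scaleC_prod_def)
  qed
qed

text \<open>Up to the factor 1/2, \<open>a + lift K a\<close> is the component of \<open>a\<close>
  in \<open>Hplus K\<close>: that component must lie in \<open>S\<close>, while the other one is
  free in \<open>T\<close>.\<close>

lemma A_op_eq: "A_op K S = {a \<in> T. a + lift K a \<in> S}"
proof -
  have adj: "adjoint_in (Hminus K) (S \<inter> Hminus K \<times> Hminus K) = {b \<in> T. lift K b = - b}"
  proof (intro equalityI subsetI)
    fix b assume b: "b \<in> adjoint_in (Hminus K) (S \<inter> Hminus K \<times> Hminus K)"
    then have Kb: "lift K b = - b"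
      by (auto simp: adjoint_in_def Hminus_eq lift_def prod_eq_iff)
    have "b \<in> T" unfolding mem_op_adjoint
    proof
      fix a assume "a \<in> S"
      \<comment> \<open>Since \<open>lift K b = - b\<close>, pairing with \<open>b\<close> sees only
        the component of \<open>a\<close> in \<open>Hminus K\<close>; \<open>d\<close> is twice that
        component.\<close>
      define d where "d = a - lift K a"
      have d: "d \<in> S" "lift K d = - d"
        using \<open>a \<in> S\<close> by (auto simp: d_def lift_simps intro: S_closed lift_S)
      have "(fst d, snd d) \<in> S \<inter> Hminus K \<times> Hminus K"
        using d by (simp add: Hminus_eq lift_def prod_eq_iff mem_Times_iff)
      then have "symplectic d b = 0"
        using b by (force simp: adjoint_in_def symplectic_def)
      moreover have "symplectic d b = 2 * symplectic a b"
        by (simp add: d_def symplectic_simps symplectic_lift Kb)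
      ultimately show "symplectic a b = 0" by simp
    qed
    with Kb show "b \<in> {b \<in> T. lift K b = - b}" by simp
  next
    fix b assume "b \<in> {b \<in> T. lift K b = - b}"
    then have "K (fst b) = - fst b" "K (snd b) = - snd b" "b \<in> T"
      by (simp_all add: lift_def prod_eq_iff)
    then show "b \<in> adjoint_in (Hminus K) (S \<inter> Hminus K \<times> Hminus K)"
      by (auto simp: adjoint_in_def Hminus_eq)
  qed
  have plus: "S \<inter> Hplus K \<times> Hplus K = {a \<in> S. lift K a = a}"
    by (auto simp: Hplus_eq lift_def prod_eq_iff)
  have "A_op K S = {a + b | a b. a \<in> S \<and> lift K a = a \<and> b \<in> T \<and> lift K b = - b}"
    unfolding A_op_def op_sum_eq adj plus by blast
  also have "\<dots> = {a \<in> T. a + lift K a \<in> S}"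
  proof (intro equalityI subsetI)
    fix c assume "c \<in> {a + b | a b. a \<in> S \<and> lift K a = a \<and> b \<in> T \<and> lift K b = - b}"
    then obtain a b where *: "c = a + b" "a \<in> S" "lift K a = a" "b \<in> T" "lift K b = - b" by blast
    then have "c + lift K c = a + a" unfolding *(1) lift_simps *(3,5) by simp
    then have "c + lift K c \<in> S" using *(2) by (simp add: S_closed)
    with * show "c \<in> {a \<in> T. a + lift K a \<in> S}"
      using S_subset_T by (auto intro: T_closed)
  next
    fix c assume c: "c \<in> {a \<in> T. a + lift K a \<in> S}"
    define a where "a = (1/2) *\<^sub>C (c + lift K c)"
    define b where "b = (1/2) *\<^sub>C (c - lift K c)"
    have "c = a + b" by (simp add: a_def b_def half_sum_diff)
    moreover have "a \<in> S" "b \<in> T" using c by (auto simp: a_def b_def intro!: S_closed T_closed lift_T)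
    moreover have "lift K a = a" "lift K b = - b"
      by (simp_all add: a_def b_def lift_simps add.commute flip: complex_vector.scale_minus_right)
    ultimately show "c \<in> {a + b | a b. a \<in> S \<and> lift K a = a \<and> b \<in> T \<and> lift K b = - b}" by blast
  qed
  finally show ?thesis .
qed

text \<open>For \<open>b\<close> in \<open>T\<close> the element \<open>b - lift K b\<close> belongs
  to \<open>A_op K S\<close>. Testing with it moves \<open>K\<close> to the other argument, and
  \<open>S_double_adjoint\<close> applies. Conversely, a pairing of \<open>b\<close> with
  \<open>a\<close> splits into two halves, each containing a factor from \<open>S\<close>.\<close>

lemma adjoint_A_op: "op_adjoint (A_op K S) = {a \<in> T. a - lift K a \<in> S}"
proof (intro equalityI subsetI)
  fix a assume a: "a \<in> op_adjoint (A_op K S)"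
  have "S \<subseteq> A_op K S"
    using S_subset_T by (auto simp: A_op_eq intro!: S_closed lift_S)
  with a have "a \<in> T" by (auto simp: mem_op_adjoint)
  moreover have "a - lift K a \<in> S"
  proof (rule S_double_adjoint)
    show "a - lift K a \<in> T" using \<open>a \<in> T\<close> by (intro T_closed lift_T)
    fix b assume "b \<in> T"
    then have "b - lift K b \<in> A_op K S"
      by (auto simp: A_op_eq lift_simps intro!: T_closed lift_T S_closed)
    then have "symplectic (b - lift K b) a = 0" using a by (simp add: mem_op_adjoint)
    then have "symplectic b (a - lift K a) = 0" by (simp add: symplectic_simps symplectic_lift)
    then show "symplectic (a - lift K a) b = 0" by (subst symplectic_commute) simp
  qed
  ultimately show "a \<in> {a \<in> T. a - lift K a \<in> S}" by simp
next
  fix a assume a: "a \<in> {a \<in> T. a - lift K a \<in> S}"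
  show "a \<in> op_adjoint (A_op K S)" unfolding mem_op_adjoint
  proof
    fix b assume "b \<in> A_op K S"
    then have "b \<in> T" "b + lift K b \<in> S" by (auto simp: A_op_eq)
    then have "symplectic b (a - lift K a) = 0" "symplectic (b + lift K b) a = 0"
      using a by (auto intro: symplectic_T_S symplectic_S_T)
    then have "2 * symplectic b a = 0"
      by (simp add: symplectic_simps symplectic_lift)
    then show "symplectic b a = 0" by simp
  qed
qed

text \<open>Replacing \<open>K\<close> by its negative swaps the two eigenspaces, so results on
  \<open>A_op\<close> cover both members of \<open>Xi2\<close>.\<close>

lemma adjoint_A_op_eq_A_op_uminus: "op_adjoint (A_op K S) = A_op (\<lambda>x. - K x) S"
proof -
  interpret m: reducing_involution S "\<lambda>x. - K x" by (rule uminus)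
  show ?thesis
    by (simp add: m.A_op_eq adjoint_A_op) (simp add: lift_def scaleC_prod_def minus_prod_def plus_prod_def)
qed

lemma subspace_A_op: "complex_vector.subspace (A_op K S)"
proof (rule complex_vector.subspaceI)
  show "0 \<in> A_op K S" by (simp add: A_op_eq T_closed S_closed lift_simps)
next
  fix a b assume "a \<in> A_op K S" "b \<in> A_op K S"
  then have "a \<in> T" "b \<in> T" "(a + lift K a) + (b + lift K b) \<in> S"
    by (auto simp: A_op_eq intro: S_closed)
  then show "a + b \<in> A_op K S"
    by (auto simp: A_op_eq lift_simps algebra_simps intro: T_closed)
next
  fix c a assume "a \<in> A_op K S"
  then have "a \<in> T" "c *\<^sub>C (a + lift K a) \<in> S"
    by (auto simp: A_op_eq intro: S_closed)
  then show "c *\<^sub>C a \<in> A_op K S"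
    by (auto simp: A_op_eq lift_simps scaleC_add_right intro: T_closed)
qed

lemma S_subset_A_op: "S \<subseteq> A_op K S"
  using S_subset_T by (auto simp: A_op_eq intro!: S_closed lift_S)

end

text \<open>The second involution occurs in two roles: as \<open>J\<^sub>\<beta>\<close>, which
  exchanges the eigenspaces of \<open>J\<^sub>\<alpha>\<close>, and as
  \<open>J\<^sub>\<gamma>\<close>, which defines \<open>A_op\<close>.\<close>

locale anticommuting_reduction =
  closed_symmetric S + J: reducing_involution S J + R: reducing_involution S R
  for S :: "('a::complex_hilbert \<times> 'a) set" and J R +
  assumes anticommute: "J (R x) = - R (J x)"
begin

lemma lift_anticommute: "lift J (lift R a) = - lift R (lift J a)"
  by (simp add: lift_def anticommute)

text \<open>\<open>J\<close> exchanges the eigenspaces of \<open>R\<close>, so conjugation by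
  \<open>J\<close> turns the operator into its adjoint.\<close>

lemma A_op_in_Sigma: "A_op R S \<in> Sigma_ext J S"
proof -
  have "linear_operator (A_op R S)"
    unfolding linear_operator_iff_subspace
    using R.subspace_A_op single_valued_T by (auto simp: R.A_op_eq single_valued_def)
  moreover have "gr J \<odot> op_adjoint (A_op R S) = A_op R S \<odot> gr J"
  proof (subst op_prod_gr_eq_iff, simp, rule allI)
    fix a
    have "lift J a \<in> T \<longleftrightarrow> a \<in> T"
      using J.lift_T J.lift_simps(6) by metis
    moreover have "lift J a + lift R (lift J a) = lift J (a - lift R a)"
      by (simp add: J.lift_simps lift_anticommute)
    ultimately show "a \<in> op_adjoint (A_op R S) \<longleftrightarrow> lift J a \<in> A_op R S"
      unfolding R.adjoint_A_op by (simp add: R.A_op_eq J.lift_S_iff)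
  qed
  ultimately show ?thesis
    using R.S_subset_A_op by (simp add: Sigma_ext_def)
qed

text \<open>If \<open>A_op R S - \<mu>\<close> were bijective, surjectivity on the half where the
  operator is \<open>S\<close>, and injectivity on the half where it is the full adjoint, would
  collide: \<open>J\<close> identifies the halves and forces \<open>S = T\<close>.\<close>

lemma A_op_resolvent_set:
  assumes "S \<noteq> T"
  shows "resolvent_set (A_op R S) = {}"
proof (rule ccontr)
  assume "resolvent_set (A_op R S) \<noteq> {}"
  then obtain \<mu> B where "{(x, y - \<mu> *\<^sub>C x) | x y. (x, y) \<in> A_op R S}\<inverse> = gr B"
    by (auto simp: resolvent_set_def)
  moreover have "{(x, y - \<mu> *\<^sub>C x) | x y. (x, y) \<in> A_op R S}\<inverse> = (\<lambda>a. (shift \<mu> a, fst a)) ` A_op R S"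
    unfolding resolvent_graph by auto
  ultimately have B: "(\<lambda>a. (shift \<mu> a, fst a)) ` A_op R S = gr B" by simp
  have surj: "\<exists>a\<in>A_op R S. shift \<mu> a = y" for y
  proof -
    have "(y, B y) \<in> gr B" by (simp add: gr_def)
    then show ?thesis unfolding B[symmetric] by auto
  qed
  have inj: "a = 0" if "a \<in> A_op R S" "shift \<mu> a = 0" for a
  proof -
    have "(shift \<mu> a, fst a) \<in> gr B"
      using that(1) unfolding B[symmetric] by (rule imageI)
    moreover have "(0, 0) \<in> gr B"
      using imageI[OF complex_vector.subspace_0[OF R.subspace_A_op], of "\<lambda>a. (shift \<mu> a, fst a)"]
      unfolding B by (simp add: shift_simps)
    ultimately have "fst a = 0" using that(2) by (simp add: gr_def shift_simps)
    with that(2) show ?thesis by (simp add: shift_def prod_eq_iff)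
  qed
  have plus: "x + lift R x \<in> S" if "x \<in> T" for x
  proof -
    define y where "y = x + lift R x"
    have y: "y \<in> T" "lift R y = y"
      using that by (auto simp: y_def R.lift_simps add.commute intro: T_closed R.lift_T)
    obtain a where a: "a \<in> A_op R S" "shift \<mu> a = shift \<mu> y" using surj by blast
    \<comment> \<open>The \<open>R\<close>-fixed part of \<open>a\<close> lies in \<open>S\<close>
      and still solves the equation, because \<open>shift \<mu> y\<close> is fixed by
      \<open>R\<close>.\<close>
    define p where "p = (1/2) *\<^sub>C (a + lift R a)"
    have p: "p \<in> S" "lift R p = p"
      using a(1) by (auto simp: p_def R.A_op_eq R.lift_simps add.commute intro!: S_closed)
    have lift_shift: "shift \<mu> (lift R a) = R (shift \<mu> a)" for a
      by (simp add: shift_def lift_def R.simps)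
    have "shift \<mu> p = (1/2) *\<^sub>C (shift \<mu> y + shift \<mu> (lift R y))"
      unfolding p_def shift_simps lift_shift a(2) ..
    then have "shift \<mu> (y - p) = 0" by (simp add: shift_simps y)
    \<comment> \<open>\<open>y - p\<close> is an eigenpair in the \<open>R\<close>-fixed half.
      \<open>J\<close> carries it to the other half, where every eigenpair of \<open>T\<close>
      belongs to \<open>A_op R S\<close>, so injectivity applies.\<close>
    define n where "n = lift J (y - p)"
    have "shift \<mu> n = J (shift \<mu> (y - p))"
      unfolding n_def by (simp add: shift_def lift_def J.simps)
    with \<open>shift \<mu> (y - p) = 0\<close> have "shift \<mu> n = 0" by simp
    have "n \<in> T" unfolding n_def using y p S_subset_T by (auto intro!: J.lift_T T_closed)
    have "n = - lift R n"
      using lift_anticommute[of "y - p"] by (simp add: n_def R.lift_simps p y)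
    then have "n + lift R n = 0" by (simp only: eq_neg_iff_add_eq_0)
    with \<open>n \<in> T\<close> have "n \<in> A_op R S" by (simp add: R.A_op_eq S_closed)
    with \<open>shift \<mu> n = 0\<close> have "n = 0" using inj by blast
    then have "lift J (lift J (y - p)) = lift J 0" unfolding n_def by (rule arg_cong)
    then have "y - p = 0" by (simp add: J.lift_simps)
    with p show ?thesis by (simp add: y_def)
  qed
  have "T \<subseteq> S"
  proof
    fix x assume "x \<in> T"
    \<comment> \<open>Applying \<open>plus\<close> to \<open>lift J x\<close> yields the
      corresponding statement for the other eigenspace of \<open>R\<close>.\<close>
    have "lift J x + lift R (lift J x) \<in> S" using plus J.lift_T \<open>x \<in> T\<close> by blast
    also have "lift J x + lift R (lift J x) = lift J (x - lift R x)"
      by (simp add: J.lift_simps lift_anticommute)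
    finally have "x - lift R x \<in> S" by (simp add: J.lift_S_iff)
    then have "(1/2) *\<^sub>C (x + lift R x) + (1/2) *\<^sub>C (x - lift R x) \<in> S"
      by (rule S_closed(1)[OF S_closed(3)[OF plus[OF \<open>x \<in> T\<close>]] S_closed(3)])
    then show "x \<in> S" by (simp add: half_sum_diff)
  qed
  with S_subset_T assms show False by blast
qed

lemma A_op_in_Xi:
  assumes "S \<noteq> T"
  shows "{A_op R S, op_adjoint (A_op R S)} \<subseteq> {A \<in> Sigma_ext J S. resolvent_set A = {}}"
proof -
  interpret m: reducing_involution S "\<lambda>x. - R x" by (rule R.uminus)
  interpret m: anticommuting_reduction S J "\<lambda>x. - R x"
    by unfold_locales (simp add: J.simps anticommute)
  show ?thesis
    using A_op_in_Sigma m.A_op_in_Sigma A_op_resolvent_set[OF assms] m.A_op_resolvent_set[OF assms]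
    by (simp add: R.adjoint_A_op_eq_A_op_uminus)
qed

end

section \<open>Defect spaces\<close>

context anticommuting_reduction
begin

text \<open>The defect space of the copy of \<open>S\<close> acting in the fixed space of
  \<open>J\<close>.\<close>

definition Eplus :: "complex \<Rightarrow> 'a set"
  where "Eplus \<mu> = {n \<in> eigenspace T \<mu>. J n = n}"

lemma EplusD: "n \<in> Eplus \<mu> \<Longrightarrow> eigenpair \<mu> n \<in> T" "n \<in> Eplus \<mu> \<Longrightarrow> J n = n"
  by (simp_all add: Eplus_def eigenspace_iff)

lemma Eplus_diff: "n \<in> Eplus \<mu> \<Longrightarrow> m \<in> Eplus \<mu> \<Longrightarrow> n - m \<in> Eplus \<mu>"
  by (simp add: Eplus_def eigenspace_iff eigenpair_simps J.simps T_closed)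

lemma Eplus_scale: "n \<in> Eplus \<mu> \<Longrightarrow> c *\<^sub>C n \<in> Eplus \<mu>"
  by (simp add: Eplus_def eigenspace_iff eigenpair_simps J.simps T_closed)

lemma R_eigenspace: "n \<in> eigenspace T \<mu> \<Longrightarrow> R n \<in> eigenspace T \<mu>"
  using R.lift_T by (fastforce simp: eigenspace_iff R.lift_simps)

lemma J_eigenspace: "n \<in> eigenspace T \<mu> \<Longrightarrow> J n \<in> eigenspace T \<mu>"
  using J.lift_T by (fastforce simp: eigenspace_iff J.lift_simps)

lemma subspace_eigenspace: "complex_vector.subspace (eigenspace T \<mu>)"
  by (rule complex_vector.subspaceI) (simp_all add: eigenspace_iff eigenpair_simps T_closed)

lemmas eigenspace_closed = complex_vector.subspace_add[OF subspace_eigenspace]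
  complex_vector.subspace_diff[OF subspace_eigenspace]
  complex_vector.subspace_scale[OF subspace_eigenspace]
  complex_vector.subspace_0[OF subspace_eigenspace]

text \<open>\<open>R\<close> carries the component negated by \<open>J\<close> into the fixed space,
  so the defect space consists of two copies of \<open>Eplus \<mu>\<close>.\<close>

lemma eigenspace_split:
  assumes "n \<in> eigenspace T \<mu>"
  obtains x y where "x \<in> Eplus \<mu>" "y \<in> Eplus \<mu>" "n = x + R y"
proof (rule that[of "(1/2) *\<^sub>C (n + J n)" "(1/2) *\<^sub>C R (n - J n)"])
  show "(1/2) *\<^sub>C (n + J n) \<in> Eplus \<mu>" "(1/2) *\<^sub>C R (n - J n) \<in> Eplus \<mu>"
    using assms by (simp_all add: Eplus_def eigenspace_closed J_eigenspace R_eigenspace J.simps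
        anticommute R.simps add.commute)
  show "n = (1/2) *\<^sub>C (n + J n) + R ((1/2) *\<^sub>C R (n - J n))"
    by (simp only: R.scaleC R.involutive half_sum_diff)
qed

lemma T_split:
  assumes "a \<in> T"
  obtains p q where "p \<in> T" "q \<in> T" "lift J p = p" "lift J q = q" "a = p + lift R q"
proof (rule that[of "(1/2) *\<^sub>C (a + lift J a)" "(1/2) *\<^sub>C lift R (a - lift J a)"])
  show "(1/2) *\<^sub>C (a + lift J a) \<in> T" "(1/2) *\<^sub>C lift R (a - lift J a) \<in> T"
    using assms by (auto intro!: T_closed R.lift_T J.lift_T)
  show "lift J ((1/2) *\<^sub>C (a + lift J a)) = (1/2) *\<^sub>C (a + lift J a)"
    by (simp add: J.lift_simps add.commute)
  show "lift J ((1/2) *\<^sub>C lift R (a - lift J a)) = (1/2) *\<^sub>C lift R (a - lift J a)"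
    by (simp add: J.lift_simps lift_anticommute R.lift_simps)
  show "a = (1/2) *\<^sub>C (a + lift J a) + lift R ((1/2) *\<^sub>C lift R (a - lift J a))"
    by (simp only: R.lift_simps half_sum_diff)
qed

text \<open>Averaging the decomposition over \<open>J\<close> keeps each summand in its space, as
  \<open>J\<close> preserves \<open>S\<close> and the defect spaces.\<close>

lemma von_Neumann_plus:
  assumes "a \<in> T" "lift J a = a" "Im \<mu> \<noteq> 0"
  obtains s n m where "s \<in> S" "lift J s = s" "n \<in> Eplus \<mu>" "m \<in> Eplus (cnj \<mu>)"
    "a = s + eigenpair \<mu> n + eigenpair (cnj \<mu>) m"
proof -
  obtain s n m where *: "s \<in> S" "n \<in> eigenspace T \<mu>" "m \<in> eigenspace T (cnj \<mu>)"
    "a = s + eigenpair \<mu> n + eigenpair (cnj \<mu>) m"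
    using von_Neumann[OF assms(1,3)] by metis
  define P :: "'a \<Rightarrow> 'a" where "P x = (1/2) *\<^sub>C (x + J x)" for x
  have P: "J (P x) = P x" for x by (simp add: P_def J.simps add.commute)
  have eig: "P x \<in> Eplus \<nu>" if "x \<in> eigenspace T \<nu>" for x \<nu>
    using that P by (simp add: Eplus_def) (simp add: P_def eigenspace_closed J_eigenspace)
  have sS: "(1/2) *\<^sub>C (s + lift J s) \<in> S" using *(1) by (intro S_closed J.lift_S)
  have "a = (1/2) *\<^sub>C (a + lift J a)" using assms(2) by simp
  also have "\<dots> = (1/2) *\<^sub>C (s + lift J s) + eigenpair \<mu> (P n) + eigenpair (cnj \<mu>) (P m)"
    unfolding *(4) by (simp add: P_def J.lift_simps eigenpair_simps scaleC_add_right)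
  finally have eq: "a = (1/2) *\<^sub>C (s + lift J s) + eigenpair \<mu> (P n) + eigenpair (cnj \<mu>) (P m)" .
  show ?thesis
    by (rule that[OF sS _ eig[OF *(2)] eig[OF *(3)] eq]) (simp add: J.lift_simps add.commute)
qed

lemma Eplus_line_of_dim_2:
  assumes "complex_vector.dim (eigenspace T \<mu>) = 2"
  obtains e where "e \<in> Eplus \<mu>" "e \<noteq> 0" "\<And>n. n \<in> Eplus \<mu> \<Longrightarrow> \<exists>c. n = c *\<^sub>C e"
proof -
  obtain B where B: "B \<subseteq> eigenspace T \<mu>" "complex_vector.independent B"
      "eigenspace T \<mu> \<subseteq> complex_vector.span B" "card B = 2"
    using complex_vector.basis_exists[of "eigenspace T \<mu>"] unfolding assms by blast
  \<comment> \<open>An infinite \<open>B\<close> would have cardinality 0.\<close>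
  then have "finite B" using card.infinite by fastforce
  have "\<exists>e. e \<in> Eplus \<mu> \<and> e \<noteq> 0"
  proof (rule ccontr)
    assume "\<not> (\<exists>e. e \<in> Eplus \<mu> \<and> e \<noteq> 0)"
    then have none: "x = 0" if "x \<in> Eplus \<mu>" for x using that by blast
    have "n = 0" if n: "n \<in> eigenspace T \<mu>" for n
    proof -
      obtain x y where "x \<in> Eplus \<mu>" "y \<in> Eplus \<mu>" and "n = x + R y"
        by (rule eigenspace_split[OF n])
      moreover from this have "x = 0" "y = 0" by (auto intro: none)
      ultimately show ?thesis by simp
    qed
    then have "B \<subseteq> {0}" using B(1) by blast
    moreover have "0 \<notin> B" using B(2) complex_vector.dependent_zero by blast
    ultimately have "B = {}" by blast
    with B(4) show False by simp
  qed
  then obtain e where e: "e \<in> Eplus \<mu>" "e \<noteq> 0" by blast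
  have "\<exists>c. n = c *\<^sub>C e" if n: "n \<in> Eplus \<mu>" for n
  proof (rule ccontr)
    assume no: "\<nexists>c. n = c *\<^sub>C e"
    \<comment> \<open>If \<open>n\<close> and \<open>e\<close> were independent, \<open>R e\<close>
      would be a third independent vector: \<open>J\<close> fixes their span but negates
      \<open>R e\<close>.\<close>
    have fixed: "complex_vector.span {n, e} \<subseteq> {x. J x = x}"
      using n e(1) by (intro complex_vector.span_minimal complex_vector.subspaceI)
        (auto simp: Eplus_def J.simps)
    have Re: "R e \<notin> complex_vector.span {n, e}"
    proof
      assume "R e \<in> complex_vector.span {n, e}"
      then have "J (R e) = R e" using fixed by blast
      then have "- R e = R e" using e(1) by (simp add: anticommute Eplus_def)
      then have "R e + R e = 0" by (simp add: neg_eq_iff_add_eq_0)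
      then have "R e = 0" using half_add_self[of "R e"] by simp
      then show False using e(2) R.involutive[of e] by simp
    qed
    have ne: "n \<notin> complex_vector.span {e}"
      using no by (auto simp: complex_vector.span_singleton)
    have ind: "complex_vector.independent {R e, n, e}"
      by (intro complex_vector.independent_insertI Re ne) (use e(2) in \<open>auto simp: complex_vector.independent_empty\<close>)
    have "R e \<noteq> n" "R e \<noteq> e"
      using Re complex_vector.span_base[of n "{n, e}"] complex_vector.span_base[of e "{n, e}"] by auto
    moreover have "n \<noteq> e" using ne complex_vector.span_base[of e "{e}"] by auto
    ultimately have "card {R e, n, e} = 3" by simp
    moreover have "{R e, n, e} \<subseteq> complex_vector.span B"
      using n e(1) B(3) R_eigenspace by (auto simp: Eplus_def)
    ultimately show False
      using complex_vector.independent_span_bound[OF \<open>finite B\<close> ind] B(4) by simp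
  qed
  with e that show ?thesis by blast
qed

end

locale deficiency_two_reduction = anticommuting_reduction +
  assumes deficiency: "deficiency_indices S = (2, 2)"
begin

text \<open>The indices describe only the points \<open>\<i>\<close> and \<open>- \<i>\<close>. Von
  Neumann coordinates at the one in the half plane of \<mu> transfer the dimension to \<mu>.\<close>

lemma Eplus_line:
  assumes "Im \<mu> \<noteq> 0"
  obtains e where "e \<in> Eplus \<mu>" "e \<noteq> 0" "\<And>n. n \<in> Eplus \<mu> \<Longrightarrow> \<exists>c. n = c *\<^sub>C e"
proof -
  define \<nu> where "\<nu> = (if Im \<mu> > 0 then \<i> else - \<i>)"
  have signs: "Im \<nu> \<noteq> 0" "Im \<nu> * Im (cnj \<mu>) < 0" "Im \<mu> * Im (cnj \<nu>) < 0"
    using assms by (auto simp: \<nu>_def)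
  have "complex_vector.dim (eigenspace T \<nu>) = 2"
    using deficiency by (simp add: deficiency_indices_def \<nu>_def)
  then obtain e where e: "e \<in> Eplus \<nu>" "e \<noteq> 0" "\<And>n. n \<in> Eplus \<nu> \<Longrightarrow> \<exists>c. n = c *\<^sub>C e"
    using Eplus_line_of_dim_2 by metis
  have lift_e: "lift J (eigenpair \<nu> e) = eigenpair \<nu> e" if "e \<in> Eplus \<nu>" for e \<nu>
    using that by (simp add: J.lift_simps Eplus_def)
  obtain s n m where *: "s \<in> S" "n \<in> Eplus \<mu>" "m \<in> Eplus (cnj \<mu>)"
      "eigenpair \<nu> e = s + eigenpair \<mu> n + eigenpair (cnj \<mu>) m"
    using von_Neumann_plus[OF EplusD(1)[OF e(1)] lift_e[OF e(1)] assms] by metis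
  have "n \<noteq> 0"
  proof
    assume "n = 0"
    then have "eigenpair \<nu> e - eigenpair (cnj \<mu>) m \<in> S" using * by (simp add: eigenpair_simps)
    then have "e = 0"
      using opposite_half_planes[OF _ _ signs(2)] e(1) *(3) by (auto simp: Eplus_def)
    with e(2) show False ..
  qed
  \<comment> \<open>Modulo \<open>S\<close>, a vector at \<mu> has one coordinate along
    \<open>e\<close> and a remainder from the opposite half plane.\<close>
  have coord: "\<exists>c m. m \<in> Eplus (cnj \<nu>) \<and> eigenpair \<mu> k - eigenpair \<nu> (c *\<^sub>C e) - eigenpair (cnj \<nu>) m \<in> S"
    if k: "k \<in> Eplus \<mu>" for k
  proof -
    obtain s n m where *: "s \<in> S" "n \<in> Eplus \<nu>" "m \<in> Eplus (cnj \<nu>)"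
      "eigenpair \<mu> k = s + eigenpair \<nu> n + eigenpair (cnj \<nu>) m"
      using von_Neumann_plus[OF EplusD(1)[OF k] lift_e[OF k] signs(1)] by metis
    obtain c where "n = c *\<^sub>C e" using e(3)[OF *(2)] ..
    with * show ?thesis by (intro exI[of _ c] exI[of _ m]) simp
  qed
  have zero: "k = 0" if "k \<in> Eplus \<mu>" "m \<in> Eplus (cnj \<nu>)" "eigenpair \<mu> k - eigenpair (cnj \<nu>) m \<in> S"
    for k m
    using opposite_half_planes[OF _ _ signs(3)] that by (auto simp: Eplus_def)
  have "\<exists>c. k = c *\<^sub>C n" if k: "k \<in> Eplus \<mu>" for k
  proof -
    obtain c1 m1 where 1: "m1 \<in> Eplus (cnj \<nu>)"
        "eigenpair \<mu> n - eigenpair \<nu> (c1 *\<^sub>C e) - eigenpair (cnj \<nu>) m1 \<in> S"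
      using coord[OF *(2)] by blast
    obtain c2 m2 where 2: "m2 \<in> Eplus (cnj \<nu>)"
        "eigenpair \<mu> k - eigenpair \<nu> (c2 *\<^sub>C e) - eigenpair (cnj \<nu>) m2 \<in> S"
      using coord[OF k] by blast
    have "c1 \<noteq> 0"
    proof
      assume "c1 = 0"
      then have "eigenpair \<mu> n - eigenpair (cnj \<nu>) m1 \<in> S" using 1(2) by (simp add: eigenpair_simps)
      then show False using zero[OF *(2) 1(1)] \<open>n \<noteq> 0\<close> by blast
    qed
    \<comment> \<open>This multiple cancels the coordinates along \<open>e\<close>; what remains of
      \<open>k - c *\<^sub>C n\<close> comes from the opposite half plane, so it vanishes by
      \<open>zero\<close>.\<close>
    define c where "c = c2 / c1"
    have "eigenpair \<mu> (k - c *\<^sub>C n) - eigenpair (cnj \<nu>) (m2 - c *\<^sub>C m1)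
        = (eigenpair \<mu> k - eigenpair \<nu> (c2 *\<^sub>C e) - eigenpair (cnj \<nu>) m2)
          - c *\<^sub>C (eigenpair \<mu> n - eigenpair \<nu> (c1 *\<^sub>C e) - eigenpair (cnj \<nu>) m1)"
      using \<open>c1 \<noteq> 0\<close>
      by (simp add: c_def eigenpair_simps complex_vector.scale_right_diff_distrib scaleC_scaleC)
    then have "eigenpair \<mu> (k - c *\<^sub>C n) - eigenpair (cnj \<nu>) (m2 - c *\<^sub>C m1) \<in> S"
      using 1(2) 2(2) by (simp add: S_closed)
    then have "k - c *\<^sub>C n = 0"
      using zero[of "k - c *\<^sub>C n" "m2 - c *\<^sub>C m1"] k *(2) 1(1) 2(1) by (simp add: Eplus_diff Eplus_scale)
    then show ?thesis by (intro exI[of _ c]) simp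
  qed
  with *(2) \<open>n \<noteq> 0\<close> that show ?thesis by blast
qed

lemma S_neq_T: "S \<noteq> T"
proof -
  obtain e where e: "e \<in> Eplus \<i>" "e \<noteq> 0"
    by (rule Eplus_line[of \<i>]) simp_all
  have "eigenpair \<i> e \<notin> S"
  proof
    assume "eigenpair \<i> e \<in> S"
    then have "symplectic (eigenpair \<i> e) (eigenpair \<i> e) = 0"
      by (rule symplectic_S_T) (rule EplusD(1)[OF e(1)])
    then show False using e(2) by (simp add: symplectic_eigenpair)
  qed
  with EplusD(1)[OF e(1)] show ?thesis by blast
qed

end

section \<open>Extensions with empty resolvent set\<close>

lemma norm_le_of_orthogonal:
  fixes x y :: "'a::complex_hilbert"
  assumes "cinner x y = 0"
  shows "norm x \<le> norm (x + y)" "norm y \<le> norm (x + y)"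
proof -
  have le: "norm u \<le> norm v" if "cinner u v = cinner u u" for u v :: 'a
  proof -
    have "(norm u)\<^sup>2 = cmod (cinner u v)"
      unfolding that cinner_same norm_of_real by simp
    also have "\<dots> \<le> norm u * norm v" by (rule Cauchy_Schwarz_cinner)
    finally show ?thesis by (cases "u = 0") (simp_all add: power2_eq_square)
  qed
  have "cinner y x = 0" using assms cinner_commute[of y x] by simp
  then show "norm x \<le> norm (x + y)" "norm y \<le> norm (x + y)"
    using assms by (auto intro!: le simp: cinner_simps)
qed

text \<open>The bound yields injectivity of \<open>A - \<mu>\<close> as well as boundedness of the
  inverse.\<close>

lemma resolvent_setI:
  assumes sub: "complex_vector.subspace A"
    and surj: "\<And>y. \<exists>a\<in>A. shift \<mu> a = y"
    and bound: "\<And>a. a \<in> A \<Longrightarrow> norm (fst a) \<le> norm (shift \<mu> a) * C"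
  shows "\<mu> \<in> resolvent_set A"
proof -
  have inj: "fst a = fst b" if "a \<in> A" "b \<in> A" "shift \<mu> a = shift \<mu> b" for a b
    using bound[OF complex_vector.subspace_diff[OF sub that(1,2)]] that(3) by (simp add: shift_simps)
  obtain g where g: "\<And>y. g y \<in> A" "\<And>y. shift \<mu> (g y) = y" using surj by metis
  define B where "B y = fst (g y)" for y
  have B: "B (shift \<mu> a) = fst a" if "a \<in> A" for a
    unfolding B_def using inj[OF g(1) that] g(2) by blast
  have scale: "B (c *\<^sub>C x) = c *\<^sub>C B x" for c x
    using B[OF complex_vector.subspace_scale[OF sub g(1), of c x]] by (simp add: shift_simps g(2) B_def)
  have "bounded_linear B"
  proof (rule bounded_linear_intro)
    fix x y
    show "B (x + y) = B x + B y"
      using B[OF complex_vector.subspace_add[OF sub g(1) g(1), of x y]]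
      by (simp add: shift_simps g(2) B_def)
  next
    fix r x show "B (r *\<^sub>R x) = r *\<^sub>R B x" by (simp add: scaleR_scaleC scale)
  next
    fix x show "norm (B x) \<le> norm x * C" using bound[OF g(1), of x] by (simp add: B_def g(2))
  qed
  then have "bounded_clinear B" by (simp add: bounded_clinear_def scale)
  moreover have "((\<lambda>a. (fst a, shift \<mu> a)) ` A)\<inverse> = gr B"
  proof (intro equalityI subsetI)
    fix p assume "p \<in> ((\<lambda>a. (fst a, shift \<mu> a)) ` A)\<inverse>"
    then show "p \<in> gr B" by (auto simp: gr_def B)
  next
    fix p assume "p \<in> gr B"
    then obtain y where "p = (shift \<mu> (g y), fst (g y))" by (auto simp: gr_def B_def g(2))
    then show "p \<in> ((\<lambda>a. (fst a, shift \<mu> a)) ` A)\<inverse>" using g(1) by auto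
  qed
  ultimately show ?thesis unfolding resolvent_set_def resolvent_graph by blast
qed

text \<open>The alternative is dimension at most one or everything.\<close>

lemma plane_subspace_cases:
  fixes f g :: "'a::complex_hilbert"
  assumes sub: "complex_vector.subspace W"
    and plane: "\<And>w. w \<in> W \<Longrightarrow> \<exists>c d. w = c *\<^sub>C f + d *\<^sub>C g"
  obtains w\<^sub>0 where "w\<^sub>0 \<in> W" "\<And>w. w \<in> W \<Longrightarrow> \<exists>c. w = c *\<^sub>C w\<^sub>0" | "f \<in> W" "g \<in> W"
proof (cases "\<exists>w\<^sub>0\<in>W. \<forall>w\<in>W. \<exists>c. w = c *\<^sub>C w\<^sub>0")
  case True
  then show ?thesis using that(1) by blast
next
  case False
  have "0 \<in> W" using sub by (rule complex_vector.subspace_0)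
  with False obtain v where v: "v \<in> W" "v \<noteq> 0"
    by (metis complex_vector.scale_zero_right)
  with False obtain w where w: "w \<in> W" "\<And>c. w \<noteq> c *\<^sub>C v" by blast
  obtain a b where ab: "v = a *\<^sub>C f + b *\<^sub>C g" using plane[OF v(1)] by blast
  obtain c d where cd: "w = c *\<^sub>C f + d *\<^sub>C g" using plane[OF w(1)] by blast
  \<comment> \<open>The determinant of \<open>v\<close>, \<open>w\<close> in terms of
    \<open>f\<close>, \<open>g\<close>; when it is nonzero, Cramer's rule recovers \<open>f\<close>
    and \<open>g\<close>.\<close>
  define D where "D = a * d - b * c"
  have "D \<noteq> 0"
  proof
    assume "D = 0"
    then have D: "a * d = b * c" by (simp add: D_def)
    show False
    proof (cases "a = 0")
      case True
      with v(2) ab have "b \<noteq> 0" by auto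
      with True D have "c = 0" by auto
      then have "w = (d / b) *\<^sub>C v" using True \<open>b \<noteq> 0\<close> by (simp add: ab cd scaleC_scaleC)
      with w(2) show False by blast
    next
      case False
      with D have "d = c / a * b" by (simp add: field_simps)
      then have "w = (c / a) *\<^sub>C v" using False by (simp add: ab cd scaleC_scaleC scaleC_add_right)
      with w(2) show False by blast
    qed
  qed
  have "(1 / D) *\<^sub>C (d *\<^sub>C v - b *\<^sub>C w) \<in> W" "(1 / D) *\<^sub>C (a *\<^sub>C w - c *\<^sub>C v) \<in> W"
    using v(1) w(1) sub by (auto intro!: complex_vector.subspace_scale complex_vector.subspace_diff)
  moreover have "(1 / D) *\<^sub>C (d *\<^sub>C v - b *\<^sub>C w) = f"
  proof -
    have "d *\<^sub>C v - b *\<^sub>C w = (d * a - b * c) *\<^sub>C f + (d * b - b * d) *\<^sub>C g"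
      by (simp only: ab cd scaleC_add_right scaleC_scaleC complex_vector.scale_left_diff_distrib)
        (simp add: mult.commute)
    then show ?thesis using \<open>D \<noteq> 0\<close> by (simp add: D_def mult.commute scaleC_scaleC)
  qed
  moreover have "(1 / D) *\<^sub>C (a *\<^sub>C w - c *\<^sub>C v) = g"
  proof -
    have "a *\<^sub>C w - c *\<^sub>C v = (a * c - c * a) *\<^sub>C f + (a * d - c * b) *\<^sub>C g"
      by (simp only: ab cd scaleC_add_right scaleC_scaleC complex_vector.scale_left_diff_distrib)
        (simp add: mult.commute)
    then show ?thesis using \<open>D \<noteq> 0\<close> by (simp add: D_def mult.commute scaleC_scaleC)
  qed
  ultimately show ?thesis using that(2) by simp
qed

context anticommuting_reduction
begin

text \<open>\<open>J\<close>-self-adjointness says that \<open>A\<close> is its own annihilator for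
  \<open>symplectic a (lift J b)\<close>; the last two conclusions are the two inclusions.\<close>

lemma Sigma_extD:
  assumes "A \<in> Sigma_ext J S"
  shows "complex_vector.subspace A" "S \<subseteq> A" "A \<subseteq> T"
    "\<And>a b. a \<in> A \<Longrightarrow> b \<in> A \<Longrightarrow> symplectic a (lift J b) = 0"
    "\<And>a. (\<And>b. b \<in> A \<Longrightarrow> symplectic b (lift J a) = 0) \<Longrightarrow> a \<in> A"
proof -
  have A: "linear_operator A" "S \<subseteq> A" "gr J \<odot> op_adjoint A = A \<odot> gr J"
    using assms by (simp_all add: Sigma_ext_def)
  show "complex_vector.subspace A" using A(1) by (simp add: linear_operator_iff_subspace)
  show "S \<subseteq> A" by (rule A(2))
  have adj: "a \<in> op_adjoint A \<longleftrightarrow> lift J a \<in> A" for a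
    using op_prod_gr_eq_iff[where K = J, OF J.involutive] A(3) by blast
  have adj': "lift J a \<in> op_adjoint A \<longleftrightarrow> a \<in> A" for a
    using adj[of "lift J a"] by (simp add: J.lift_simps)
  show "symplectic a (lift J b) = 0" if "a \<in> A" "b \<in> A" for a b
    using adj'[of b] that by (simp add: mem_op_adjoint)
  show "a \<in> A" if "\<And>b. b \<in> A \<Longrightarrow> symplectic b (lift J a) = 0" for a
    using adj'[of a] that by (simp add: mem_op_adjoint)
  show "A \<subseteq> T"
  proof
    fix a assume "a \<in> A"
    then have "lift J a \<in> op_adjoint A" by (simp add: adj')
    then have "lift J a \<in> T" using A(2) unfolding mem_op_adjoint by blast
    then show "a \<in> T" using J.lift_T[of "lift J a"] by (simp add: J.lift_simps)
  qed
qed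

text \<open>A \<open>J\<close>-self-adjoint operator is its own annihilator for \<open>symplectic a (lift J b)\<close>, hence maximal.\<close>

lemma Sigma_ext_subset_imp_eq:
  assumes "A \<in> Sigma_ext J S" "B \<in> Sigma_ext J S" "B \<subseteq> A"
  shows "A = B"
proof
  show "A \<subseteq> B"
  proof
    fix a assume "a \<in> A"
    show "a \<in> B"
    proof (rule Sigma_extD(5)[OF assms(2)])
      fix b assume "b \<in> B"
      with assms(3) have "b \<in> A" by blast
      then show "symplectic b (lift J a) = 0" using \<open>a \<in> A\<close> by (rule Sigma_extD(4)[OF assms(1)])
    qed
  qed
qed (rule assms(3))

end

section \<open>Non-real eigenvalues of an extension with empty resolvent set\<close>

context deficiency_two_reduction
begin

lemma orthogonal_R:
  assumes "J x = x" "J y = y"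
  shows "cinner x (R y) = 0" "cinner (R x) y = 0"
proof -
  have "cinner x (R y) = cinner (J x) (R y)" by (simp only: assms(1))
  also have "\<dots> = - cinner x (R y)" unfolding J.symmetric by (simp add: anticommute assms cinner_simps)
  finally have "cinner x (R y) + cinner x (R y) = 0" by (simp only: eq_neg_iff_add_eq_0)
  then show "cinner x (R y) = 0" by (simp add: mult_2[symmetric])
  then show "cinner (R x) y = 0" by (simp add: R.symmetric)
qed

text \<open>The two summands are orthogonal and \<open>R\<close> is isometric, which bounds the
  coefficients; the bounds feed the resolvent estimate in
  \<open>Sigma_ext_eigenvector\<close>.\<close>

lemma eigenspace_basis:
  assumes e: "e \<in> Eplus \<mu>" "e \<noteq> 0" "\<And>n. n \<in> Eplus \<mu> \<Longrightarrow> \<exists>c. n = c *\<^sub>C e"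
    and w: "w \<in> eigenspace T \<mu>"
  obtains c d where "w = c *\<^sub>C e + d *\<^sub>C R e" "cmod c * norm e \<le> norm w" "cmod d * norm e \<le> norm w"
proof -
  obtain x y where xy: "x \<in> Eplus \<mu>" "y \<in> Eplus \<mu>" "w = x + R y"
    by (rule eigenspace_split[OF w])
  obtain c where c: "x = c *\<^sub>C e" using e(3)[OF xy(1)] ..
  obtain d where d: "y = d *\<^sub>C e" using e(3)[OF xy(2)] ..
  have "cinner (c *\<^sub>C e) (d *\<^sub>C R e) = 0"
    using orthogonal_R[of e e] EplusD(2)[OF e(1)] by (simp add: cinner_simps)
  note le = norm_le_of_orthogonal[OF this]
  have "norm (R e) = norm e"
  proof -
    have "cinner (R e) (R e) = cinner e e" by (simp add: R.symmetric)
    then have "(norm (R e))\<^sup>2 = (norm e)\<^sup>2" unfolding cinner_same of_real_eq_iff .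
    then show ?thesis by simp
  qed
  with le that[of c d] show ?thesis by (simp add: xy(3) c d R.simps norm_scaleC)
qed

text \<open>Without eigenvectors at \<mu>, a dimension count makes \<open>A - \<mu>\<close>
  surjective with bounded inverse, so \<mu> would lie in the resolvent set.\<close>

lemma Sigma_ext_eigenvector:
  assumes A: "A \<in> Sigma_ext J S" "resolvent_set A = {}" and im: "Im \<mu> \<noteq> 0"
  obtains x where "x \<noteq> 0" "eigenpair \<mu> x \<in> A"
proof (rule ccontr)
  assume "\<not> thesis"
  with that have none: "x = 0" if "eigenpair \<mu> x \<in> A" for x by (metis \<open>eigenpair \<mu> x \<in> A\<close>)
  note subA = Sigma_extD(1)[OF A(1)]
  note A_closed = complex_vector.subspace_add[OF subA] complex_vector.subspace_diff[OF subA]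
    complex_vector.subspace_scale[OF subA] complex_vector.subspace_0[OF subA]
  have SA: "s \<in> A" if "s \<in> S" for s using Sigma_extD(2)[OF A(1)] that by blast
  have imc: "Im (cnj \<mu>) \<noteq> 0" using im by simp
  obtain e where e: "e \<in> Eplus \<mu>" "e \<noteq> 0" by (rule Eplus_line[OF im])
  obtain f where f: "f \<in> Eplus (cnj \<mu>)" "f \<noteq> 0" "\<And>n. n \<in> Eplus (cnj \<mu>) \<Longrightarrow> \<exists>c. n = c *\<^sub>C f"
    using Eplus_line[OF imc] by blast
  \<comment> \<open>The components at \<open>cnj \<mu>\<close> of elements of \<open>A\<close>
    modulo \<open>S\<close>; they measure how far the range of \<open>A - \<mu>\<close> exceeds that
    of \<open>S - \<mu>\<close>.\<close>
  define W where "W = {w \<in> eigenspace T (cnj \<mu>).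
    \<exists>n\<in>eigenspace T \<mu>. eigenpair \<mu> n + eigenpair (cnj \<mu>) w \<in> A}"
  have W_D: "\<exists>w n s. w \<in> W \<and> n \<in> eigenspace T \<mu> \<and> s \<in> S \<and> a = s + eigenpair \<mu> n + eigenpair (cnj \<mu>) w"
    if "a \<in> A" for a
  proof -
    have "a \<in> T" using Sigma_extD(3)[OF A(1)] that by blast
    then obtain s n m where *: "s \<in> S" "n \<in> eigenspace T \<mu>" "m \<in> eigenspace T (cnj \<mu>)"
      "a = s + eigenpair \<mu> n + eigenpair (cnj \<mu>) m"
      by (rule von_Neumann[OF _ im])
    have "a - s \<in> A" using that SA[OF *(1)] by (rule A_closed(2))
    then have "m \<in> W" using * by (auto simp: W_def)
    with * show ?thesis by blast
  qed
  have subW: "complex_vector.subspace W"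
  proof (rule complex_vector.subspaceI)
    have "eigenpair \<mu> 0 + eigenpair (cnj \<mu>) 0 \<in> A" by (simp add: eigenpair_simps A_closed)
    then show "0 \<in> W" unfolding W_def using eigenspace_closed(4) by blast
  next
    fix x y assume "x \<in> W" "y \<in> W"
    then obtain n m where *: "n \<in> eigenspace T \<mu>" "m \<in> eigenspace T \<mu>"
      "eigenpair \<mu> n + eigenpair (cnj \<mu>) x \<in> A" "eigenpair \<mu> m + eigenpair (cnj \<mu>) y \<in> A"
      by (auto simp: W_def)
    have "eigenpair \<mu> (n + m) + eigenpair (cnj \<mu>) (x + y) \<in> A"
      using A_closed(1)[OF *(3,4)] by (simp add: eigenpair_simps add_ac)
    then show "x + y \<in> W"
      using \<open>x \<in> W\<close> \<open>y \<in> W\<close> eigenspace_closed(1) *(1,2) unfolding W_def by blast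
  next
    fix c x assume "x \<in> W"
    then obtain n where *: "n \<in> eigenspace T \<mu>" "eigenpair \<mu> n + eigenpair (cnj \<mu>) x \<in> A"
      by (auto simp: W_def)
    have "eigenpair \<mu> (c *\<^sub>C n) + eigenpair (cnj \<mu>) (c *\<^sub>C x) \<in> A"
      using A_closed(3)[OF *(2), of c] by (simp add: eigenpair_simps scaleC_add_right)
    then show "c *\<^sub>C x \<in> W"
      using \<open>x \<in> W\<close> eigenspace_closed(3) *(1) unfolding W_def by blast
  qed
  have plane: "\<exists>c d. w = c *\<^sub>C f + d *\<^sub>C R f" if "w \<in> W" for w
  proof -
    have "w \<in> eigenspace T (cnj \<mu>)" using that by (simp add: W_def)
    then show ?thesis using eigenspace_basis[OF f] by metis
  qed
  \<comment> \<open>If \<open>W\<close> had dimension at most one, \<open>A\<close> would be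
    \<open>S\<close> plus at most a line. The plane of eigenvectors at \<mu> would then contain one
    annihilating all of \<open>A\<close>, hence in \<open>A\<close> by maximality.\<close>
  have "f \<in> W \<and> R f \<in> W"
  proof (rule plane_subspace_cases[OF subW plane])
    fix w0 assume w0: "w0 \<in> W" "\<And>w. w \<in> W \<Longrightarrow> \<exists>c. w = c *\<^sub>C w0"
    from w0(1) obtain n0 where n0: "n0 \<in> eigenspace T \<mu>" "eigenpair \<mu> n0 + eigenpair (cnj \<mu>) w0 \<in> A"
      by (auto simp: W_def)
    define a0 where "a0 = eigenpair \<mu> n0 + eigenpair (cnj \<mu>) w0"
    define p where "p = symplectic a0 (lift J (eigenpair \<mu> e))"
    define q where "q = symplectic a0 (lift J (eigenpair \<mu> (R e)))"
    \<comment> \<open>A nonzero solution of the single linear condition that makes \<open>n\<close>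
      orthogonal to \<open>a0\<close>.\<close>
    define c d where "c = (if p = 0 then 1 else cnj q)" and "d = (if p = 0 then 0 else - cnj p)"
    have cd: "cnj c * p + cnj d * q = 0" by (simp add: c_def d_def)
    define n where "n = c *\<^sub>C e + d *\<^sub>C R e"
    have n: "n \<in> eigenspace T \<mu>"
      using e(1) by (auto simp: n_def Eplus_def intro!: eigenspace_closed R_eigenspace)
    have orth0: "symplectic a0 (lift J (eigenpair \<mu> n)) = 0"
      using cd by (simp add: n_def eigenpair_simps J.lift_simps symplectic_simps p_def q_def)
    have "eigenpair \<mu> n \<in> A"
    proof (rule Sigma_extD(5)[OF A(1)])
      fix b assume "b \<in> A"
      then obtain w m s where *: "w \<in> W" "m \<in> eigenspace T \<mu>" "s \<in> S"
        "b = s + eigenpair \<mu> m + eigenpair (cnj \<mu>) w" using W_D by blast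
      obtain k where k: "w = k *\<^sub>C w0" using w0(2)[OF *(1)] ..
      \<comment> \<open>With the component at \<open>cnj \<mu>\<close> removed, only an eigenpair of
        \<open>A\<close> at \<mu> is left, which is zero by \<open>none\<close>.\<close>
      have "b - s - k *\<^sub>C a0 \<in> A"
        using \<open>b \<in> A\<close> SA[OF *(3)] n0(2) by (auto simp: a0_def intro!: A_closed)
      moreover have "b - s - k *\<^sub>C a0 = eigenpair \<mu> (m - k *\<^sub>C n0)"
        by (simp add: *(4) k a0_def eigenpair_simps scaleC_add_right)
      ultimately have "b - s - k *\<^sub>C a0 = 0" using none by (metis eigenpair_simps(4))
      then have b: "b = s + k *\<^sub>C a0" by (simp add: algebra_simps)
      have "symplectic s (lift J (eigenpair \<mu> n)) = 0"
        using *(3) n by (intro symplectic_S_T J.lift_T) (simp_all add: eigenspace_iff)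
      then show "symplectic b (lift J (eigenpair \<mu> n)) = 0"
        by (simp add: b symplectic_simps orth0)
    qed
    then have "n = 0" by (rule none)
    then have "cinner n e = 0" "cinner n (R e) = 0" by simp_all
    then have "c = 0" "d = 0"
      using orthogonal_R[of e e] EplusD(2)[OF e(1)] e(2) R.involutive[of e]
      by (auto simp: n_def cinner_simps R.symmetric)
    then have False by (auto simp: c_def d_def split: if_splits)
    then show ?thesis ..
  qed blast+
  then have fW: "f \<in> W" "R f \<in> W" by simp_all
  have ne: "cnj \<mu> - \<mu> \<noteq> 0" using im by (auto simp: complex_eq_iff)
  have surj: "\<exists>a\<in>A. shift \<mu> a = w" if "w \<in> W" for w
  proof -
    have "(1 / (cnj \<mu> - \<mu>)) *\<^sub>C w \<in> W"
      using that by (rule complex_vector.subspace_scale[OF subW])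
    then obtain n where "eigenpair \<mu> n + eigenpair (cnj \<mu>) ((1 / (cnj \<mu> - \<mu>)) *\<^sub>C w) \<in> A"
      by (auto simp: W_def)
    then show ?thesis
      by (rule bexI[rotated]) (use ne in \<open>simp add: shift_simps scaleC_scaleC\<close>)
  qed
  obtain a where a: "a \<in> A" "shift \<mu> a = f" using surj[OF fW(1)] by blast
  obtain b where b: "b \<in> A" "shift \<mu> b = R f" using surj[OF fW(2)] by blast
  have inj: "x = 0" if "x \<in> A" "shift \<mu> x = 0" for x
  proof -
    have x: "x = eigenpair \<mu> (fst x)" using that(2) by (simp add: shift_eq_0_iff)
    then have "fst x = 0" using that(1) none by metis
    with x show ?thesis by (simp add: eigenpair_simps)
  qed
  \<comment> \<open>The first term bounds the part in \<open>S\<close> by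
    \<open>norm_shift_ge\<close>; the others come from the preimages of \<open>f\<close> and
    \<open>R f\<close>, whose coefficients are at most \<open>norm y / norm f\<close>.\<close>
  define C where "C = 1 / \<bar>Im \<mu>\<bar> + (norm (fst a) + norm (fst b)) / norm f"
  have solve: "\<exists>x\<in>A. shift \<mu> x = y \<and> norm (fst x) \<le> norm y * C" for y
  proof -
    obtain s w where sw: "s \<in> S" "w \<in> eigenspace T (cnj \<mu>)" "y = shift \<mu> s + w"
      "cinner w (shift \<mu> s) = 0"
      by (rule range_shift_decomposition[OF im])
    obtain c d where cd: "w = c *\<^sub>C f + d *\<^sub>C R f" "cmod c * norm f \<le> norm w" "cmod d * norm f \<le> norm w"
      by (rule eigenspace_basis[OF f sw(2)])
    have le: "norm w \<le> norm y" "norm (shift \<mu> s) \<le> norm y"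
      using norm_le_of_orthogonal[OF sw(4)] by (simp_all add: sw(3) add.commute)
    define x where "x = s + (c *\<^sub>C a + d *\<^sub>C b)"
    have "x \<in> A" using SA[OF sw(1)] a(1) b(1) by (auto simp: x_def intro!: A_closed)
    moreover have "shift \<mu> x = y"
      by (simp add: x_def shift_simps a b sw(3) cd(1))
    moreover have "norm (fst x) \<le> norm y * C"
    proof -
      have "norm (fst x) \<le> norm (fst s) + (cmod c * norm (fst a) + cmod d * norm (fst b))"
        unfolding x_def fst_add fst_scaleC norm_scaleC[symmetric]
        by (intro norm_triangle_mono norm_triangle_ineq order_refl)
      also have "norm (fst s) \<le> norm y / \<bar>Im \<mu>\<bar>"
        using norm_shift_ge[OF sw(1), of \<mu>] le(2) im by (simp add: field_simps)
      also have "cmod c * norm (fst a) \<le> norm y / norm f * norm (fst a)"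
        using cd(2) le(1) f(2) by (intro mult_right_mono) (simp_all add: field_simps)
      also have "cmod d * norm (fst b) \<le> norm y / norm f * norm (fst b)"
        using cd(3) le(1) f(2) by (intro mult_right_mono) (simp_all add: field_simps)
      also have "norm y / \<bar>Im \<mu>\<bar> + (norm y / norm f * norm (fst a) + norm y / norm f * norm (fst b))
          = norm y * C"
        by (simp add: C_def algebra_simps add_divide_distrib)
      finally show ?thesis by simp
    qed
    ultimately show ?thesis by blast
  qed
  have "\<mu> \<in> resolvent_set A"
  proof (rule resolvent_setI[OF subA])
    show "\<exists>x\<in>A. shift \<mu> x = y" for y using solve by blast
    \<comment> \<open>By injectivity \<open>x\<close> coincides with the bounded solution
      \<open>x'\<close> for the same right side.\<close>
    fix x assume "x \<in> A"
    obtain x' where x': "x' \<in> A" "shift \<mu> x' = shift \<mu> x" "norm (fst x') \<le> norm (shift \<mu> x) * C"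
      using solve by blast
    have "x - x' = 0" by (rule inj) (simp_all add: A_closed \<open>x \<in> A\<close> x' shift_simps)
    with x'(3) show "norm (fst x) \<le> norm (shift \<mu> x) * C" by simp
  qed
  with A(2) show False by simp
qed

end

section \<open>Boundary triplets and the Weyl function\<close>

context closed_symmetric
begin

text \<open>By surjectivity some \<open>b\<close> has boundary values
  \<open>\<Gamma>\<^sub>1 a\<close> and \<open>- \<Gamma>\<^sub>0 a\<close>; Green's identity then
  gives the sum of the squared norms as a pairing of \<open>S\<close> with \<open>T\<close>.\<close>

lemma boundary_triplet_zero_on_S:
  assumes "boundary_triplet S \<Gamma>\<^sub>0 \<Gamma>\<^sub>1" "a \<in> S"
  shows "\<Gamma>\<^sub>0 (fst a) = 0" "\<Gamma>\<^sub>1 (fst a) = 0"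
proof -
  have green: "symplectic a b = cinner (\<Gamma>\<^sub>1 (fst a)) (\<Gamma>\<^sub>0 (fst b)) - cinner (\<Gamma>\<^sub>0 (fst a)) (\<Gamma>\<^sub>1 (fst b))"
    if "a \<in> T" "b \<in> T" for a b
    using assms(1) that unfolding boundary_triplet_def symplectic_def by fastforce
  have "(\<Gamma>\<^sub>1 (fst a), - \<Gamma>\<^sub>0 (fst a)) \<in> (\<lambda>x. (\<Gamma>\<^sub>0 x, \<Gamma>\<^sub>1 x)) ` Domain T"
    using assms(1) unfolding boundary_triplet_def by simp
  then obtain b where b: "b \<in> T" "\<Gamma>\<^sub>0 (fst b) = \<Gamma>\<^sub>1 (fst a)" "\<Gamma>\<^sub>1 (fst b) = - \<Gamma>\<^sub>0 (fst a)"
    by (metis (no_types, lifting) DomainE Pair_inject fst_conv imageE)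
  have "symplectic a b = 0" using assms(2) b(1) by (rule symplectic_S_T)
  moreover have "a \<in> T" using assms(2) S_subset_T by blast
  ultimately have "cinner (\<Gamma>\<^sub>1 (fst a)) (\<Gamma>\<^sub>1 (fst a)) + cinner (\<Gamma>\<^sub>0 (fst a)) (\<Gamma>\<^sub>0 (fst a)) = 0"
    using green[OF _ b(1), of a] by (simp only: b(2,3) cinner_minus_right) simp
  then have "(norm (\<Gamma>\<^sub>1 (fst a)))\<^sup>2 + (norm (\<Gamma>\<^sub>0 (fst a)))\<^sup>2 = 0"
    unfolding cinner_same by (simp only: of_real_add[symmetric] of_real_eq_0_iff)
  then show "\<Gamma>\<^sub>0 (fst a) = 0" "\<Gamma>\<^sub>1 (fst a) = 0"
    by (simp_all add: add_nonneg_eq_0_iff)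
qed

text \<open>Boundary values depend only on classes modulo \<open>S\<close>.\<close>

lemma weyl_function_subset:
  fixes \<Gamma>\<^sub>0 \<Gamma>\<^sub>1 :: "'a \<Rightarrow> 'h::complex_hilbert"
  assumes triplet: "boundary_triplet S \<Gamma>\<^sub>0 \<Gamma>\<^sub>1"
    and mod: "\<And>f. f \<in> eigenspace T \<mu> \<Longrightarrow> \<exists>g\<in>eigenspace T \<nu>. eigenpair \<mu> f - eigenpair \<nu> g \<in> S"
  shows "weyl_function S \<Gamma>\<^sub>0 \<Gamma>\<^sub>1 \<mu> \<subseteq> weyl_function S \<Gamma>\<^sub>0 \<Gamma>\<^sub>1 \<nu>"
proof
  fix p assume "p \<in> weyl_function S \<Gamma>\<^sub>0 \<Gamma>\<^sub>1 \<mu>"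
  then obtain f where f: "f \<in> eigenspace T \<mu>" "p = (\<Gamma>\<^sub>0 f, \<Gamma>\<^sub>1 f)"
    by (auto simp: weyl_function_def)
  obtain g where g: "g \<in> eigenspace T \<nu>" "eigenpair \<mu> f - eigenpair \<nu> g \<in> S"
    using mod[OF f(1)] ..
  note zero = boundary_triplet_zero_on_S[OF triplet g(2)]
  have "g \<in> Domain T" "f - g \<in> Domain T"
    using g S_subset_T by (auto simp: eigenspace_def eigenpair_def)
  then have add: "\<Gamma> (g + (f - g)) = \<Gamma> g + \<Gamma> (f - g)" if "clinear_on (Domain T) \<Gamma>" for \<Gamma> :: "'a \<Rightarrow> 'h"
    using that unfolding clinear_on_def by blast
  have "clinear_on (Domain T) \<Gamma>\<^sub>0" "clinear_on (Domain T) \<Gamma>\<^sub>1"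
    using triplet by (simp_all add: boundary_triplet_def)
  from this[THEN add] have "\<Gamma>\<^sub>0 f = \<Gamma>\<^sub>0 g" "\<Gamma>\<^sub>1 f = \<Gamma>\<^sub>1 g"
    using zero by (simp_all add: eigenpair_simps)
  then show "p \<in> weyl_function S \<Gamma>\<^sub>0 \<Gamma>\<^sub>1 \<nu>"
    using f(2) g(1) by (auto simp: weyl_function_def)
qed

end

text \<open>A positive product of imaginary parts means that both points lie in the same open half
  plane.\<close>

lemma nonconstant_on_half_planes:
  assumes "\<not> (f constant_on {\<mu>. Im \<mu> > 0} \<and> f constant_on {\<mu>. Im \<mu> < 0})"
  obtains \<mu> \<nu> where "Im \<mu> * Im \<nu> > 0" "f \<mu> \<noteq> f \<nu>"
proof -
  from assms consider "\<not> f constant_on {\<mu>. Im \<mu> > 0}" | "\<not> f constant_on {\<mu>. Im \<mu> < 0}" by blast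
  then show ?thesis
  proof cases
    case 1
    then have "\<not> (\<forall>\<mu>\<in>{\<mu>. Im \<mu> > 0}. f \<mu> = f \<i>)" unfolding constant_on_def by blast
    then show ?thesis using that[of _ \<i>] by auto
  next
    case 2
    then have "\<not> (\<forall>\<mu>\<in>{\<mu>. Im \<mu> < 0}. f \<mu> = f (- \<i>))" unfolding constant_on_def by blast
    then show ?thesis using that[of _ "- \<i>"] by auto
  qed
qed

section \<open>From eigenvectors to the operators \<open>A\<^sub>\<gamma>\<close>\<close>

context deficiency_two_reduction
begin

text \<open>\<open>R\<close> transports a congruence modulo \<open>S\<close> between the lines in
  the fixed space of \<open>J\<close> to the second copy, hence to the whole eigenspaces.\<close>

lemma weyl_function_subset_Eplus:
  assumes triplet: "boundary_triplet S \<Gamma>\<^sub>0 \<Gamma>\<^sub>1"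
    and e: "\<And>n. n \<in> Eplus \<mu> \<Longrightarrow> \<exists>c. n = c *\<^sub>C e" and f: "f \<in> Eplus \<nu>"
    and mod: "eigenpair \<mu> e - eigenpair \<nu> f \<in> S"
  shows "weyl_function S \<Gamma>\<^sub>0 \<Gamma>\<^sub>1 \<mu> \<subseteq> weyl_function S \<Gamma>\<^sub>0 \<Gamma>\<^sub>1 \<nu>"
proof (rule weyl_function_subset[OF triplet])
  fix w assume "w \<in> eigenspace T \<mu>"
  then obtain x y where xy: "x \<in> Eplus \<mu>" "y \<in> Eplus \<mu>" "w = x + R y" by (rule eigenspace_split)
  obtain c where c: "x = c *\<^sub>C e" using e[OF xy(1)] ..
  obtain d where d: "y = d *\<^sub>C e" using e[OF xy(2)] ..
  show "\<exists>g\<in>eigenspace T \<nu>. eigenpair \<mu> w - eigenpair \<nu> g \<in> S"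
  proof
    show "c *\<^sub>C f + R (d *\<^sub>C f) \<in> eigenspace T \<nu>"
      using f by (auto simp: Eplus_def intro!: eigenspace_closed R_eigenspace)
    have "c *\<^sub>C (eigenpair \<mu> e - eigenpair \<nu> f) + lift R (d *\<^sub>C (eigenpair \<mu> e - eigenpair \<nu> f)) \<in> S"
      using mod by (intro S_closed(1,3) R.lift_S)
    also have "c *\<^sub>C (eigenpair \<mu> e - eigenpair \<nu> f) + lift R (d *\<^sub>C (eigenpair \<mu> e - eigenpair \<nu> f))
        = eigenpair \<mu> w - eigenpair \<nu> (c *\<^sub>C f + R (d *\<^sub>C f))"
      by (simp add: xy(3) c d eigenpair_simps R.simps R.lift_simps
          complex_vector.scale_right_diff_distrib)
    finally show "eigenpair \<mu> w - eigenpair \<nu> (c *\<^sub>C f + R (d *\<^sub>C f)) \<in> S" .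
  qed
qed

text \<open>Neutrality of the eigenpair gives \<open>cinner x (J x) = 0\<close>, so both coordinates
  have equal modulus and one can be scaled to 1.\<close>

lemma Sigma_ext_unimodular_eigenvector:
  assumes A: "A \<in> Sigma_ext J S" "resolvent_set A = {}" and im: "Im \<mu> \<noteq> 0"
    and e: "e \<in> Eplus \<mu>" "e \<noteq> 0" "\<And>n. n \<in> Eplus \<mu> \<Longrightarrow> \<exists>c. n = c *\<^sub>C e"
  obtains u where "cmod u = 1" "eigenpair \<mu> (e + u *\<^sub>C R e) \<in> A"
proof -
  obtain x where x: "x \<noteq> 0" "eigenpair \<mu> x \<in> A"
    by (rule Sigma_ext_eigenvector[OF A im])
  then have "x \<in> eigenspace T \<mu>"
    using Sigma_extD(3)[OF A(1)] by (auto simp: eigenspace_iff)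
  then obtain c d where cd: "x = c *\<^sub>C e + d *\<^sub>C R e"
    using eigenspace_basis[OF e] by metis
  have "(\<mu> - cnj \<mu>) * cinner x (J x) = 0"
    using Sigma_extD(4)[OF A(1) x(2) x(2)] by (simp add: J.lift_simps symplectic_eigenpair)
  moreover have "\<mu> - cnj \<mu> \<noteq> 0" using im by (auto simp: complex_eq_iff)
  ultimately have "cinner x (J x) = 0" by simp
  moreover have "cinner x (J x) = (c * cnj c - d * cnj d) * cinner e e"
    using orthogonal_R[of e e] EplusD(2)[OF e(1)]
    by (simp add: cd J.simps anticommute cinner_add_left cinner_add_right cinner_minus_right
        cinner_diff_right cinner_scaleC_left cinner_scaleC_right R.symmetric algebra_simps)
  ultimately have "c * cnj c = d * cnj d" using e(2) by simp
  then have "complex_of_real ((cmod c)\<^sup>2) = complex_of_real ((cmod d)\<^sup>2)"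
    by (simp only: complex_norm_square)
  then have norms: "cmod c = cmod d" by (simp only: of_real_eq_iff) simp
  have "c \<noteq> 0" using norms x(1) by (auto simp: cd)
  have "(1 / c) *\<^sub>C eigenpair \<mu> x \<in> A"
    using x(2) by (rule complex_vector.subspace_scale[OF Sigma_extD(1)[OF A(1)]])
  also have "(1 / c) *\<^sub>C eigenpair \<mu> x = eigenpair \<mu> (e + (d / c) *\<^sub>C R e)"
    using \<open>c \<noteq> 0\<close> by (simp add: cd eigenpair_simps scaleC_add_right scaleC_scaleC)
  finally show ?thesis
    using norms \<open>c \<noteq> 0\<close> by (intro that[of "d / c"]) (auto simp: norm_divide)
qed

lemma symplectic_orthogonal_R:
  assumes "lift J p = p" "lift J q = q"
  shows "symplectic p (lift R q) = 0" "symplectic (lift R p) q = 0"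
proof -
  have "symplectic p (lift R q) = symplectic (lift J p) (lift R q)" by (simp only: assms(1))
  also have "\<dots> = - symplectic p (lift R q)"
    unfolding J.symplectic_lift lift_anticommute assms(2) symplectic_simps ..
  finally have "symplectic p (lift R q) + symplectic p (lift R q) = 0"
    by (simp only: eq_neg_iff_add_eq_0)
  then show "symplectic p (lift R q) = 0" by (simp add: mult_2[symmetric])
  then show "symplectic (lift R p) q = 0" by (simp only: R.symplectic_lift)
qed

text \<open>The copies do not interact and \<open>J\<close> flips the sign of the second. For
  unimodular \<open>u\<close>, \<open>v\<close> the factor vanishes only when they agree.\<close>

lemma symplectic_twisted:
  assumes "lift J p = p" "lift J q = q"
  shows "symplectic (p + u *\<^sub>C lift R p) (lift J (q + v *\<^sub>C lift R q)) = (1 - u * cnj v) * symplectic p q"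
proof -
  have "lift J (q + v *\<^sub>C lift R q) = q - v *\<^sub>C lift R q"
    by (simp add: J.lift_simps lift_anticommute assms(2) complex_vector.scale_minus_right)
  then show ?thesis
    using symplectic_orthogonal_R[OF assms]
    by (simp only: symplectic_simps R.symplectic_lift_lift) (simp add: algebra_simps)
qed

lemma Sigma_ext_contains_twisted:
  assumes A: "A \<in> Sigma_ext J S" "resolvent_set A = {}"
    and triplet: "boundary_triplet S \<Gamma>\<^sub>0 \<Gamma>\<^sub>1"
    and half_plane: "Im \<mu> * Im \<nu> > 0"
    and weyl: "weyl_function S \<Gamma>\<^sub>0 \<Gamma>\<^sub>1 \<mu> \<noteq> weyl_function S \<Gamma>\<^sub>0 \<Gamma>\<^sub>1 \<nu>"
  obtains u where "cmod u = 1" "\<And>p. p \<in> T \<Longrightarrow> lift J p = p \<Longrightarrow> p + u *\<^sub>C lift R p \<in> A"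
proof -
  have im: "Im \<mu> \<noteq> 0" "Im \<nu> \<noteq> 0" "Im (cnj \<mu>) \<noteq> 0" using half_plane by auto
  obtain e where e: "e \<in> Eplus \<mu>" "e \<noteq> 0" "\<And>n. n \<in> Eplus \<mu> \<Longrightarrow> \<exists>c. n = c *\<^sub>C e"
    using Eplus_line[OF im(1)] by blast
  obtain f where f: "f \<in> Eplus \<nu>" "f \<noteq> 0" "\<And>n. n \<in> Eplus \<nu> \<Longrightarrow> \<exists>c. n = c *\<^sub>C f"
    using Eplus_line[OF im(2)] by blast
  obtain g where g: "g \<in> Eplus (cnj \<mu>)" "\<And>n. n \<in> Eplus (cnj \<mu>) \<Longrightarrow> \<exists>c. n = c *\<^sub>C g"
    using Eplus_line[OF im(3)] by blast
  obtain u where u: "cmod u = 1" "eigenpair \<mu> (e + u *\<^sub>C R e) \<in> A"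
    by (rule Sigma_ext_unimodular_eigenvector[OF A im(1) e])
  obtain v where v: "cmod v = 1" "eigenpair \<nu> (f + v *\<^sub>C R f) \<in> A"
    by (rule Sigma_ext_unimodular_eigenvector[OF A im(2) f])
  have lifts: "lift J (eigenpair \<mu> e) = eigenpair \<mu> e" "lift J (eigenpair \<nu> f) = eigenpair \<nu> f"
    using e(1) f(1) by (simp_all add: J.lift_simps EplusD)
  have twist: "eigenpair \<kappa> (x + c *\<^sub>C R x) = eigenpair \<kappa> x + c *\<^sub>C lift R (eigenpair \<kappa> x)" for \<kappa> x c
    by (simp add: eigenpair_simps R.lift_simps)

  \<comment> \<open>The eigenvector at \<nu> in coordinates at \<mu>. Here \<open>a\<close> is
    nonzero because the half planes agree, and \<open>b\<close> because the Weyl function separates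
    the points.\<close>
  obtain s n m where snm: "s \<in> S" "n \<in> Eplus \<mu>" "m \<in> Eplus (cnj \<mu>)"
      "eigenpair \<nu> f = s + eigenpair \<mu> n + eigenpair (cnj \<mu>) m"
    using von_Neumann_plus[OF EplusD(1)[OF f(1)] lifts(2) im(1)] by metis
  obtain a where a: "n = a *\<^sub>C e" using e(3)[OF snm(2)] ..
  have "a \<noteq> 0"
  proof
    assume "a = 0"
    then have "eigenpair \<nu> f - eigenpair (cnj \<mu>) m \<in> S"
      using snm by (simp add: a eigenpair_simps)
    moreover have "Im \<nu> * Im (cnj \<mu>) < 0" using half_plane by (simp add: mult.commute)
    ultimately show False
      using opposite_half_planes[of f \<nu> m "cnj \<mu>"] f(1,2) snm(3) by (auto simp: Eplus_def)
  qed
  have "m \<noteq> 0"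
  proof
    assume "m = 0"
    then have S1: "eigenpair \<nu> f - eigenpair \<mu> n \<in> S" using snm by (simp add: eigenpair_simps)
    have "(- 1 / a) *\<^sub>C (eigenpair \<nu> f - eigenpair \<mu> n) \<in> S"
      using S1 by (rule S_closed(3))
    also have "(- 1 / a) *\<^sub>C (eigenpair \<nu> f - eigenpair \<mu> n) = eigenpair \<mu> e - eigenpair \<nu> ((1 / a) *\<^sub>C f)"
      using \<open>a \<noteq> 0\<close> by (simp add: a eigenpair_simps complex_vector.scale_right_diff_distrib scaleC_scaleC)
    finally have S2: "eigenpair \<mu> e - eigenpair \<nu> ((1 / a) *\<^sub>C f) \<in> S" .
    have "weyl_function S \<Gamma>\<^sub>0 \<Gamma>\<^sub>1 \<mu> = weyl_function S \<Gamma>\<^sub>0 \<Gamma>\<^sub>1 \<nu>"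
      using weyl_function_subset_Eplus[OF triplet e(3) Eplus_scale[OF f(1)] S2]
        weyl_function_subset_Eplus[OF triplet f(3) snm(2) S1] by (intro equalityI) auto
    with weyl show False ..
  qed
  obtain b where b: "m = b *\<^sub>C g" using g(2)[OF snm(3)] ..
  with \<open>m \<noteq> 0\<close> have "b \<noteq> 0" by auto

  \<comment> \<open>Only the component along \<open>e\<close> contributes: \<open>s\<close> lies in
    \<open>S\<close>, and the form vanishes between eigenpairs at \<open>cnj \<mu>\<close> and
    \<mu>.\<close>
  have "symplectic (eigenpair \<nu> f) (eigenpair \<mu> e) = a * symplectic (eigenpair \<mu> e) (eigenpair \<mu> e)"
    using symplectic_S_T[OF snm(1) EplusD(1)[OF e(1)]]
    by (simp add: snm(4) symplectic_simps symplectic_eigenpair a cinner_simps)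
  then have "symplectic (eigenpair \<nu> f) (eigenpair \<mu> e) \<noteq> 0"
    using \<open>a \<noteq> 0\<close> e(2) im(1) by (simp add: symplectic_eigenpair_self)
  moreover have "(1 - v * cnj u) * symplectic (eigenpair \<nu> f) (eigenpair \<mu> e) = 0"
    using Sigma_extD(4)[OF A(1) v(2) u(2)] unfolding twist symplectic_twisted[OF lifts(2,1)] .
  ultimately have "v * cnj u = 1" by simp
  then have "v * (cnj u * u) = u" by (metis mult.assoc mult_1)
  moreover have "cnj u * u = 1" using u(1) complex_norm_square[of u] by (simp add: mult.commute)
  ultimately have "v = u" by simp

  define t where "t p = p + u *\<^sub>C lift R p" for p :: "'a \<times> 'a"
  have t_simps: "t (p + q) = t p + t q" "t (p - q) = t p - t q" "t (c *\<^sub>C p) = c *\<^sub>C t p" for p q c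
    by (simp_all add: t_def R.lift_simps scaleC_add_right complex_vector.scale_right_diff_distrib
        scaleC_scaleC mult.commute)
  have t_S: "t s \<in> A" if "s \<in> S" for s
    using Sigma_extD(2)[OF A(1)] that by (auto simp: t_def intro!: S_closed R.lift_S)
  note subA = Sigma_extD(1)[OF A(1)]
  note A_closed = complex_vector.subspace_add[OF subA] complex_vector.subspace_diff[OF subA]
    complex_vector.subspace_scale[OF subA]
  have te: "t (eigenpair \<mu> e) \<in> A" using u(2) unfolding twist t_def .
  have tf: "t (eigenpair \<nu> f) \<in> A" using v(2) unfolding twist t_def \<open>v = u\<close> .
  have tg: "t (eigenpair (cnj \<mu>) g) \<in> A"
  proof -
    \<comment> \<open>As \<open>b\<close> is nonzero, the missing direction \<open>g\<close> is
      recovered from the two eigenvectors known to give elements of \<open>A\<close>.\<close>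
    have "eigenpair (cnj \<mu>) g = (1 / b) *\<^sub>C (eigenpair \<nu> f - s - a *\<^sub>C eigenpair \<mu> e)"
      using \<open>b \<noteq> 0\<close> by (simp add: snm(4) a b eigenpair_simps scaleC_scaleC)
    then show ?thesis using te tf t_S[OF snm(1)] by (simp add: t_simps A_closed)
  qed
  have "t p \<in> A" if p: "p \<in> T" "lift J p = p" for p
  proof -
    obtain s n m where *: "s \<in> S" "n \<in> Eplus \<mu>" "m \<in> Eplus (cnj \<mu>)"
      "p = s + eigenpair \<mu> n + eigenpair (cnj \<mu>) m"
      using von_Neumann_plus[OF p im(1)] by metis
    obtain c where "n = c *\<^sub>C e" using e(3)[OF *(2)] ..
    moreover obtain d where "m = d *\<^sub>C g" using g(2)[OF *(3)] ..
    ultimately show ?thesis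
      using te tg t_S[OF *(1)] by (simp add: *(4) t_simps eigenpair_simps A_closed)
  qed
  with u(1) that show ?thesis by (simp add: t_def)
qed

text \<open>The hypotheses make \<open>K\<close> equal to -1 on every \<open>p + u R p\<close>. For
  \<open>a\<close> in \<open>A_op K S\<close>, \<open>a + lift K a\<close> is in \<open>S\<close>
  and \<open>a - lift K a\<close> has this twisted form, so \<open>A\<close> contains both;
  maximality turns the inclusion into equality.\<close>

lemma Sigma_ext_eq_A_op:
  assumes A: "A \<in> Sigma_ext J S" and u: "cmod u = 1"
    and twisted: "\<And>p. p \<in> T \<Longrightarrow> lift J p = p \<Longrightarrow> p + u *\<^sub>C lift R p \<in> A"
    and K: "anticommuting_reduction S J K"
      "\<And>x. J x = x \<Longrightarrow> K x = - (u *\<^sub>C R x)" "\<And>x. J x = x \<Longrightarrow> K (R x) = - (cnj u *\<^sub>C x)"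
  shows "A = A_op K S"
proof -
  interpret K: anticommuting_reduction S J K by (rule K(1))
  have uu: "u * cnj u = 1" using u complex_norm_square[of u] by simp
  have "A_op K S \<subseteq> A"
  proof
    fix a assume "a \<in> A_op K S"
    then have a: "a \<in> T" "a + lift K a \<in> S" by (auto simp: K.R.A_op_eq)
    obtain p q where pq: "p \<in> T" "q \<in> T" "lift J p = p" "lift J q = q" "a = p + lift R q"
      by (rule T_split[OF a(1)])
    have Kp: "lift K p = - (u *\<^sub>C lift R p)" "lift K (lift R q) = - (cnj u *\<^sub>C q)"
      using pq(3,4) by (simp_all add: lift_def prod_eq_iff K(2,3))
    \<comment> \<open>Since \<open>u * cnj u = 1\<close>, this \<open>r\<close> collects the
      \<open>J\<close>-fixed part of \<open>a - lift K a\<close>, and the rest is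
      \<open>u *\<^sub>C lift R r\<close>.\<close>
    define r where "r = p + cnj u *\<^sub>C q"
    have "r + u *\<^sub>C lift R r \<in> A"
      using pq by (intro twisted) (auto simp: r_def J.lift_simps intro!: T_closed)
    also have "r + u *\<^sub>C lift R r = a - lift K a"
      by (simp add: r_def pq(5) K.R.lift_simps Kp R.lift_simps scaleC_add_right scaleC_scaleC uu)
    finally have "a - lift K a \<in> A" .
    moreover have "a + lift K a \<in> A" using a(2) Sigma_extD(2)[OF A] by blast
    ultimately have "(1/2) *\<^sub>C (a + lift K a) + (1/2) *\<^sub>C (a - lift K a) \<in> A"
      using complex_vector.subspace_add complex_vector.subspace_scale Sigma_extD(1)[OF A] by blast
    then show "a \<in> A" by (simp only: half_sum_diff)
  qed
  then show ?thesis by (rule Sigma_ext_subset_imp_eq[OF A K.A_op_in_Sigma])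
qed

end

section \<open>The sphere of fundamental symmetries\<close>

context anticommuting_reduction
begin

text \<open>Instantiated with \<open>J\<^sub>\<alpha>\<close> and \<open>J\<^sub>\<beta>\<close>,
  the product is \<open>Jgamma\<close>.\<close>

lemma anticommuting_reduction_product: "anticommuting_reduction S J (\<lambda>x. \<i> *\<^sub>C J (R x))"
proof unfold_locales
  show "cinner (\<i> *\<^sub>C J (R x)) y = cinner x (\<i> *\<^sub>C J (R y))" for x y
    by (simp only: cinner_simps J.symmetric R.symmetric anticommute) simp
  show "lift (\<lambda>x. \<i> *\<^sub>C J (R x)) a \<in> S" if "a \<in> S" for a
  proof -
    have "\<i> *\<^sub>C lift J (lift R a) \<in> S" using that by (intro S_closed(3) J.lift_S R.lift_S)
    then show ?thesis by (simp add: lift_def scaleC_prod_def)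
  qed
qed (simp_all add: J.simps R.simps anticommute scaleC_add_right scaleC_scaleC mult.commute
    complex_vector.scale_right_diff_distrib)

text \<open>The normal form in which \<open>J\<close> acts before \<open>R\<close>, matching the
  direction of the rewrite rule \<open>anticommute\<close>.\<close>

lemma Jvec_eq:
  "Jvec J R \<alpha> x = complex_of_real (\<alpha> $ 1) *\<^sub>C J x + complex_of_real (\<alpha> $ 2) *\<^sub>C R x
     - (\<i> * complex_of_real (\<alpha> $ 3)) *\<^sub>C R (J x)"
  by (simp add: Jvec_def scaleR_scaleC anticommute scaleC_scaleC mult.commute)

text \<open>The Pauli multiplication rule with the opposite orientation. Equal unit vectors give
  involutivity; orthogonal ones give the cross product.\<close>

lemma Jvec_product:
  "\<i> *\<^sub>C Jvec J R \<alpha> (Jvec J R \<beta> x) = (\<i> * complex_of_real (\<alpha> \<bullet> \<beta>)) *\<^sub>C x + Jvec J R (cross3 \<alpha> \<beta>) x"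
  by (simp add: Jvec_eq J.simps R.simps anticommute scaleC_add_right scaleC_scaleC 
    inner_vec_def sum_3 cross3_def
    complex_vector.scale_right_diff_distrib  complex_vector.scale_left_diff_distrib scaleC_add_left algebra_simps)

lemma Jvec_linear: "Jvec J R (a *\<^sub>R \<alpha> + b *\<^sub>R \<beta>) x = a *\<^sub>R Jvec J R \<alpha> x + b *\<^sub>R Jvec J R \<beta> x"
  by (simp add: Jvec_def algebra_simps)

lemma Jvec_reducing:
  assumes "norm \<alpha> = 1"
  shows "reducing_involution S (Jvec J R \<alpha>)"
proof unfold_locales
  show "Jvec J R \<alpha> (x + y) = Jvec J R \<alpha> x + Jvec J R \<alpha> y" for x y
    by (simp add: Jvec_def J.simps R.simps scaleC_add_right algebra_simps)
  show "Jvec J R \<alpha> (c *\<^sub>C x) = c *\<^sub>C Jvec J R \<alpha> x" for c x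
    by (simp add: Jvec_def J.simps R.simps scaleC_add_right scaleR_scaleC scaleC_scaleC mult_ac)
  show "Jvec J R \<alpha> (Jvec J R \<alpha> x) = x" for x
  proof -
    have "Jvec J R 0 x = 0" by (simp add: Jvec_def)
    then have "\<i> *\<^sub>C Jvec J R \<alpha> (Jvec J R \<alpha> x) = \<i> *\<^sub>C x"
      unfolding Jvec_product using assms by (simp add: dot_square_norm)
    then show ?thesis by (rule complex_vector.scale_left_imp_eq[rotated]) simp
  qed
  show "cinner (Jvec J R \<alpha> x) y = cinner x (Jvec J R \<alpha> y)" for x y
    unfolding Jvec_def scaleR_scaleC
    by (simp only: cinner_simps J.symmetric R.symmetric anticommute) simp
  show "lift (Jvec J R \<alpha>) a \<in> S" if "a \<in> S" for a
  proof -
    have "complex_of_real (\<alpha> $ 1) *\<^sub>C lift J a + complex_of_real (\<alpha> $ 2) *\<^sub>C lift R a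
        + complex_of_real (\<alpha> $ 3) *\<^sub>C \<i> *\<^sub>C lift J (lift R a) \<in> S"
      using that by (intro S_closed(1,3) J.lift_S R.lift_S)
    then show ?thesis
      by (simp add: lift_def Jvec_def scaleR_scaleC scaleC_prod_def)
  qed
qed

lemma Jvec_anticommuting:
  assumes "norm \<alpha> = 1" "norm \<beta> = 1" "\<alpha> \<bullet> \<beta> = 0"
  shows "anticommuting_reduction S (Jvec J R \<alpha>) (Jvec J R \<beta>)"
proof -
  interpret a: reducing_involution S "Jvec J R \<alpha>" by (rule Jvec_reducing[OF assms(1)])
  interpret b: reducing_involution S "Jvec J R \<beta>" by (rule Jvec_reducing[OF assms(2)])
  show ?thesis
  proof
    fix x
    have "Jvec J R (cross3 \<beta> \<alpha>) x = - Jvec J R (cross3 \<alpha> \<beta>) x"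
      by (subst cross_skew) (simp add: Jvec_def)
    then have "\<i> *\<^sub>C Jvec J R \<alpha> (Jvec J R \<beta> x) = \<i> *\<^sub>C (- Jvec J R \<beta> (Jvec J R \<alpha> x))"
      using assms(3) by (simp add: Jvec_product complex_vector.scale_minus_right inner_commute)
    then show "Jvec J R \<alpha> (Jvec J R \<beta> x) = - Jvec J R \<beta> (Jvec J R \<alpha> x)"
      by (rule complex_vector.scale_left_imp_eq[rotated]) simp
  qed
qed

end

lemma orthogonal_unit_vector_exists:
  fixes \<alpha> :: "real ^ 3"
  assumes "norm \<alpha> = 1"
  obtains \<beta> where "norm \<beta> = 1" "\<alpha> \<bullet> \<beta> = 0"
proof -
  obtain y where "y \<noteq> 0" "orthogonal \<alpha> y"
    by (rule orthogonal_to_vector_exists[of \<alpha>]) simp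
  then show ?thesis
    using that[of "sgn y"] by (simp add: norm_sgn orthogonal_def sgn_div_norm)
qed

theorem theorem3p3:
  fixes J R :: "'a::complex_hilbert \<Rightarrow> 'a"
    and S :: "('a \<times> 'a) set"
    and \<Gamma>\<^sub>0 \<Gamma>\<^sub>1 :: "'a \<Rightarrow> 'h::complex_hilbert"
    and \<alpha> :: "real ^ 3"
  assumes "nontrivial_fundamental_symmetry J"
    and "nontrivial_fundamental_symmetry R"
    and "\<forall>x. J (R x) = - R (J x)"
    and "linear_operator S"
    and "closed S"
    and "densely_defined S"
    and "symmetric_operator S"
    and "S \<odot> gr J = gr J \<odot> S"
    and "S \<odot> gr R = gr R \<odot> S"
    and "deficiency_indices S = (2, 2)"
    and "boundary_triplet S \<Gamma>\<^sub>0 \<Gamma>\<^sub>1"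
    and "\<not> (weyl_function S \<Gamma>\<^sub>0 \<Gamma>\<^sub>1 constant_on {\<mu>. Im \<mu> > 0} \<and>
             weyl_function S \<Gamma>\<^sub>0 \<Gamma>\<^sub>1 constant_on {\<mu>. Im \<mu> < 0})"
    and "\<alpha> \<in> sphere 0 1"
  shows "Xi J R S \<alpha> = (\<Union>\<beta> \<in> {\<beta> \<in> sphere 0 1. \<alpha> \<bullet> \<beta> = 0}. Xi2 J R S \<alpha> \<beta>)"
proof -
  interpret closed_symmetric S by unfold_locales (rule assms)+
  interpret J: symmetric_involution J
    using assms(1) by (auto simp: nontrivial_fundamental_symmetry_def
        intro: fundamental_symmetry_imp_symmetric_involution)
  interpret R: symmetric_involution R
    using assms(2) by (auto simp: nontrivial_fundamental_symmetry_def
        intro: fundamental_symmetry_imp_symmetric_involution)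
  have "\<forall>a. a \<in> S \<longleftrightarrow> lift J a \<in> S" "\<forall>a. a \<in> S \<longleftrightarrow> lift R a \<in> S"
    using assms(8,9) op_prod_gr_eq_iff[where K = J, OF J.involutive, of S S]
      op_prod_gr_eq_iff[where K = R, OF R.involutive, of S S] by blast+
  then interpret JR: anticommuting_reduction S J R
    by unfold_locales (use assms(3) in blast)+
  have \<alpha>: "norm \<alpha> = 1" using assms(13) by simp
  have frame: "deficiency_two_reduction S (Jvec J R \<alpha>) (Jvec J R \<beta>)"
    if "norm \<beta> = 1" "\<alpha> \<bullet> \<beta> = 0" for \<beta>
    using JR.Jvec_anticommuting[OF \<alpha> that] assms(10)
    by (simp add: deficiency_two_reduction_def deficiency_two_reduction_axioms_def)
  have product: "anticommuting_reduction S (Jvec J R \<alpha>) (Jgamma J R \<alpha> \<beta>)"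
    if "norm \<beta> = 1" "\<alpha> \<bullet> \<beta> = 0" for \<beta>
    unfolding Jgamma_def
    by (rule anticommuting_reduction.anticommuting_reduction_product[OF JR.Jvec_anticommuting[OF \<alpha> that]])
  show ?thesis
  proof (intro equalityI subsetI)
    fix A assume "A \<in> (\<Union>\<beta> \<in> {\<beta> \<in> sphere 0 1. \<alpha> \<bullet> \<beta> = 0}. Xi2 J R S \<alpha> \<beta>)"
    then obtain \<beta> where \<beta>: "norm \<beta> = 1" "\<alpha> \<bullet> \<beta> = 0" "A \<in> Xi2 J R S \<alpha> \<beta>" by auto
    interpret K: anticommuting_reduction S "Jvec J R \<alpha>" "Jgamma J R \<alpha> \<beta>" by (rule product[OF \<beta>(1,2)])
    show "A \<in> Xi J R S \<alpha>"
      using K.A_op_in_Xi[OF deficiency_two_reduction.S_neq_T[OF frame[OF \<beta>(1,2)]]] \<beta>(3)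
      unfolding Xi_def Xi2_def by blast
  next
    fix A assume "A \<in> Xi J R S \<alpha>"
    then have A: "A \<in> Sigma_ext (Jvec J R \<alpha>) S" "resolvent_set A = {}" by (simp_all add: Xi_def)
    \<comment> \<open>An auxiliary direction that only fixes coordinates; the one attached to
      \<open>A\<close> depends on \<open>u\<close>.\<close>
    obtain \<beta> where \<beta>: "norm \<beta> = 1" "\<alpha> \<bullet> \<beta> = 0" by (rule orthogonal_unit_vector_exists[OF \<alpha>])
    interpret F: deficiency_two_reduction S "Jvec J R \<alpha>" "Jvec J R \<beta>" by (rule frame[OF \<beta>])
    obtain \<mu> \<nu> where "Im \<mu> * Im \<nu> > 0" "weyl_function S \<Gamma>\<^sub>0 \<Gamma>\<^sub>1 \<mu> \<noteq> weyl_function S \<Gamma>\<^sub>0 \<Gamma>\<^sub>1 \<nu>"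
      by (rule nonconstant_on_half_planes[OF assms(12)])
    from F.Sigma_ext_contains_twisted[OF A assms(11) this]
    obtain u where u: "cmod u = 1"
      "\<And>p. p \<in> T \<Longrightarrow> lift (Jvec J R \<alpha>) p = p \<Longrightarrow> p + u *\<^sub>C lift (Jvec J R \<beta>) p \<in> A" by blast
    \<comment> \<open>Chosen so that \<open>Jgamma J R \<alpha> \<beta>'\<close> acts as
      \<open>- u J\<^sub>\<beta>\<close> on vectors fixed by \<open>J\<^sub>\<alpha>\<close>. There
      \<open>J\<^sub>\<gamma>\<close> for \<open>cross3 \<alpha> \<beta>\<close> is
      \<open>- J\<^sub>\<beta>\<close> and for \<beta> it is \<open>- \<i> J\<^sub>\<beta>\<close>,
      which gives the weights \<open>Re u\<close> and \<open>Im u\<close>.\<close>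
    define \<beta>' where "\<beta>' = Im u *\<^sub>R \<beta> + Re u *\<^sub>R cross3 \<alpha> \<beta>"
    have cross: "norm (cross3 \<alpha> \<beta>) = 1" "cross3 \<alpha> \<beta> \<bullet> \<beta> = 0" "\<alpha> \<bullet> cross3 \<alpha> \<beta> = 0"
      using norm_cross_dot[of \<alpha> \<beta>] \<alpha> \<beta> by (simp_all add: dot_cross_self abs_square_eq_1)
    have "(norm \<beta>')\<^sup>2 = (Im u)\<^sup>2 + (Re u)\<^sup>2"
      using cross \<beta>(1) unfolding power2_norm_eq_inner norm_eq_1
      by (simp add: \<beta>'_def inner_add_left inner_add_right inner_commute power2_eq_square)
    also have "\<dots> = 1" using u(1) cmod_power2[of u] by simp
    finally have \<beta>': "norm \<beta>' = 1" "\<alpha> \<bullet> \<beta>' = 0"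
      using cross \<beta>(2) by (simp_all add: \<beta>'_def inner_add_right abs_square_eq_1)
    have K: "Jgamma J R \<alpha> \<beta>' x = (\<i> * Im u) *\<^sub>C Jvec J R \<alpha> (Jvec J R \<beta> x) - Re u *\<^sub>C Jvec J R \<beta> x" for x
    proof -
      have "Jvec J R (cross3 \<alpha> \<beta>) x = \<i> *\<^sub>C Jvec J R \<alpha> (Jvec J R \<beta> x)"
        by (simp add: JR.Jvec_product \<beta>(2))
      then show ?thesis
        by (simp add: Jgamma_def \<beta>'_def JR.Jvec_linear F.J.simps scaleR_scaleC scaleC_add_right
            scaleC_scaleC mult_ac)
    qed
    have "A = A_op (Jgamma J R \<alpha> \<beta>') S"
    proof (rule F.Sigma_ext_eq_A_op[OF A(1) u product[OF \<beta>']])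
      fix x assume x: "Jvec J R \<alpha> x = x"
      have "Jgamma J R \<alpha> \<beta>' x = - ((Re u + \<i> * Im u) *\<^sub>C Jvec J R \<beta> x)"
        by (simp add: K F.anticommute x scaleC_add_left)
      then show "Jgamma J R \<alpha> \<beta>' x = - (u *\<^sub>C Jvec J R \<beta> x)"
        by (simp only: complex_eq[symmetric])
      have "Jgamma J R \<alpha> \<beta>' (Jvec J R \<beta> x) = - ((Re u - \<i> * Im u) *\<^sub>C x)"
        by (simp add: K x complex_vector.scale_left_diff_distrib)
      moreover have "Re u - \<i> * Im u = cnj u" by (simp add: complex_eq_iff)
      ultimately show "Jgamma J R \<alpha> \<beta>' (Jvec J R \<beta> x) = - (cnj u *\<^sub>C x)" by simp
    qed
    then have "A \<in> Xi2 J R S \<alpha> \<beta>'" by (simp add: Xi2_def)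
    with \<beta>' show "A \<in> (\<Union>\<beta> \<in> {\<beta> \<in> sphere 0 1. \<alpha> \<bullet> \<beta> = 0}. Xi2 J R S \<alpha> \<beta>)" by auto
  qed
qed

end
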